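(* Suppose that $b>0$ and that there is a constant $\theta>0$ such that $\phi(z)>0$ for all $z>\theta$ and $\int_\theta^\infty \phi(z)^{-1}dz<\infty$. Then the transition semigroup $(P_t)_{t\ge 0}$ of the CBI-process with branching mechanism $\phi$ and immigration rate $a\ge 0$ is exponentially ergodic. More precisely, for any $x\ge 0$ and $t\ge 1$, $$\|P_t(x,\cdot)-\mu(\cdot)\|_{\rm var}\le 2\big(1-\exp\{-\bar v_1 x e^{-b(t-1)}\}\big)+2\bar v_1 a b^{-1}e^{-b(t-1)},$$ where $\mu$ is the stationary distribution of $(P_t)_{t\ge0}$, given by $$\int_0^\infty e^{-\lambda x}\mu(dx)=\exp\Big\{-a\int_0^\lambda z\phi(z)^{-1}dz\Big\},\qquad \lambda\ge 0,$$ and $\|\cdot\|_{\rm var}$ denotes the total variation norm.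
   Context: Let $\sigma\ge 0$ and $b\in\mathbb{R}$ be constants, $m$ a measure on $(0,\infty)$ such that $(u\wedge u^2)m(du)$ is a finite measure, and $$\phi(z)=bz+\tfrac12\sigma^2z^2+\int_0^\infty (e^{-zu}-1+zu)\,m(du),\qquad z\ge 0.$$ For $\lambda\ge 0$ let $t\mapsto v_t(\lambda)$ be the unique positive (nonnegative) solution of $\frac{\partial}{\partial t}v_t(\lambda)=-\phi(v_t(\lambda))$, $v_0(\lambda)=\lambda$. Let $\bar v_t=\lim_{\lambda\to\infty}v_t(\lambda)$ (an increasing limit), which is finite for every $t>0$ under the integral condition on $\phi$ in the claim. The CBI-process with branching mechanism $\phi$ and immigration rate $a\ge0$ is the Markov process on $\mathbb{R}_+=[0,\infty)$ with transition semigroup $(P_t)_{t\ge0}$ given by $$\int_0^\infty e^{-\lambda y}P_t(x,dy)=\exp\Big\{-xv_t(\lambda)-a\int_0^t v_s(\lambda)ds\Big\},\qquad \lambda\ge0.$$ For a finite signed measure $\nu$, $\|\nu\|_{\rm var}=\sup\{|\nu(f)|: f \text{ Borel}, |f|\le 1\}$. *)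

theory Defs
  imports "HOL-Probability.Probability"
begin

text \<open>Branching mechanism \<open>\<phi>(z) = b z + \<sigma>\<^sup>2 z\<^sup>2 / 2 + \<integral> (e\<^sup>-\<^sup>z\<^sup>u - 1 + z u) m(du)\<close>; the
  values at \<open>z < 0\<close> play no role.\<close>

definition branching_mechanism :: "real \<Rightarrow> real \<Rightarrow> real measure \<Rightarrow> real \<Rightarrow> real" where
  "branching_mechanism b \<sigma> m z =
     b * z + 1/2 * \<sigma>\<^sup>2 * z\<^sup>2 + (LINT u|m. exp (- z * u) - 1 + z * u)"

definition levy_measure :: "real measure \<Rightarrow> bool" where
  "levy_measure m \<longleftrightarrow>
     sets m = sets (restrict_space borel {0<..}) \<and>
     finite_measure (density m (\<lambda>u. ennreal (min u (u\<^sup>2))))"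

text \<open>\<open>v t l\<close> is \<open>v\<^sub>t(l)\<close>. Only times \<open>t \<ge> 0\<close> and initial values \<open>l \<ge> 0\<close> are
  constrained; the derivative at \<open>t = 0\<close> is one-sided.\<close>

definition cumulant_flow :: "(real \<Rightarrow> real) \<Rightarrow> (real \<Rightarrow> real \<Rightarrow> real) \<Rightarrow> bool" where
  "cumulant_flow \<phi> v \<longleftrightarrow>
     (\<forall>l\<ge>0. v 0 l = l \<and>
        (\<forall>t\<ge>0. v t l \<ge> 0 \<and>
           ((\<lambda>s. v s l) has_real_derivative - \<phi> (v t l)) (at t within {0..})))"

definition vbar :: "(real \<Rightarrow> real \<Rightarrow> real) \<Rightarrow> real \<Rightarrow> real" where
  "vbar v t = Lim at_top (\<lambda>l. v t l)"

definition transition_semigroup :: "'a measure \<Rightarrow> (real \<Rightarrow> 'a \<Rightarrow> 'a measure) \<Rightarrow> bool" where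
  "transition_semigroup E P \<longleftrightarrow>
     (\<forall>t\<ge>0. P t \<in> E \<rightarrow>\<^sub>M prob_algebra E) \<and>
     (\<forall>x\<in>space E. P 0 x = return E x) \<and>
     (\<forall>s\<ge>0. \<forall>t\<ge>0. \<forall>x\<in>space E. P (s + t) x = P s x \<bind> P t)"

definition stationary_distribution ::
    "'a measure \<Rightarrow> (real \<Rightarrow> 'a \<Rightarrow> 'a measure) \<Rightarrow> 'a measure \<Rightarrow> bool" where
  "stationary_distribution E P \<mu> \<longleftrightarrow>
     \<mu> \<in> space (prob_algebra E) \<and> (\<forall>t\<ge>0. \<mu> \<bind> P t = \<mu>)"

text \<open>The norm \<open>\<parallel>M - N\<parallel>\<^sub>v\<^sub>a\<^sub>r = sup {\<bar>M(f) - N(f)\<bar> : f Borel, \<bar>f\<bar> \<le> 1}\<close> of the signed measure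
  \<open>M - N\<close>, for finite measures \<open>M\<close>, \<open>N\<close> on the same measurable space (so at most 2 for
  probability measures, with no factor 1/2).\<close>

definition var_norm_diff :: "'a measure \<Rightarrow> 'a measure \<Rightarrow> real" where
  "var_norm_diff M N =
     (SUP f\<in>{f \<in> borel_measurable M. \<forall>x\<in>space M. \<bar>f x\<bar> \<le> 1}.
        \<bar>integral\<^sup>L M f - integral\<^sup>L N f\<bar>)"

definition exponentially_ergodic :: "'a measure \<Rightarrow> (real \<Rightarrow> 'a \<Rightarrow> 'a measure) \<Rightarrow> bool" where
  "exponentially_ergodic E P \<longleftrightarrow>
     (\<exists>\<mu>. stationary_distribution E P \<mu> \<and>
        (\<exists>\<rho>>0. \<exists>C. \<forall>x\<in>space E. \<forall>t\<ge>0.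
           var_norm_diff (P t x) \<mu> \<le> C x * exp (- \<rho> * t)))"

abbreviation borel_nonneg :: "real measure" where
  "borel_nonneg \<equiv> restrict_space borel {0..}"

definition cbi_semigroup ::
    "(real \<Rightarrow> real \<Rightarrow> real) \<Rightarrow> real \<Rightarrow> (real \<Rightarrow> real \<Rightarrow> real measure) \<Rightarrow> bool" where
  "cbi_semigroup v a P \<longleftrightarrow>
     transition_semigroup borel_nonneg P \<and>
     (\<forall>t\<ge>0. \<forall>x\<ge>0. \<forall>l\<ge>0.
        (LINT y|P t x. exp (- l * y)) =
          exp (- x * v t l - a * (LINT s:{0..t}|lborel. v s l)))"

end

theory Submission
  imports Defs
begin

text \<open>Write \<open>F(\<lambda>) = \<integral>\<^sub>0\<^sup>\<lambda> z/\<phi>(z) dz\<close>.  Substituting \<open>z = v\<^sub>s(\<lambda>)\<close> in the immigration integral gives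
  \<open>P\<^sub>t(x, \<cdot>)\<close> the Laplace exponent \<open>x v\<^sub>t(\<lambda>) + a (F(\<lambda>) - F(v\<^sub>t(\<lambda>)))\<close>.  As \<open>\<phi>(z) \<ge> b z\<close>, the flow satisfies
  \<open>v\<^sub>t(\<lambda>) \<le> \<lambda> e\<^sup>-\<^sup>b\<^sup>t\<close> and \<open>F(\<lambda>) \<le> \<lambda>/b\<close>.  So the exponents of \<open>P\<^sub>t(0, \<cdot>)\<close> converge to \<open>a F\<close>, the limit \<open>\<mu>\<close> exists
  by the continuity theorem for Laplace transforms, and by uniqueness of Laplace transforms \<open>\<mu>\<close> is
  the only stationary law (\<open>limit_law_exists\<close>, \<open>stationary_iff\<close>).

  The rate comes from the branching property.  \<open>P\<^sub>t(x, \<cdot>)\<close> is the convolution of \<open>P\<^sub>t(0, \<cdot>)\<close> with the law \<open>Q\<close>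
  of the descendants of the initial mass \<open>x\<close>, whose transform is \<open>exp (- x v\<^sub>t(\<lambda>))\<close>.  If \<open>v\<^sub>t \<le> w\<close>
  uniformly in \<open>\<lambda>\<close>, then letting \<open>\<lambda> \<rightarrow> \<infinity>\<close> shows that \<open>Q\<close> has an atom at \<open>0\<close> of mass at least \<open>e\<^sup>-\<^sup>x\<^sup>w\<close>: the initial
  mass has died out by then with at least this probability, and
  \<open>\<parallel>P\<^sub>t(x, \<cdot>) - P\<^sub>t(0, \<cdot>)\<parallel> \<le> 2 (1 - e\<^sup>-\<^sup>x\<^sup>w)\<close> (\<open>integral_P_diff_le\<close>).  Integrating this against \<open>\<mu>\<close> bounds
  \<open>\<parallel>P\<^sub>t(0, \<cdot>) - \<mu>\<parallel>\<close> by \<open>2 (1 - e\<^sup>-\<^sup>a\<^sup>F\<^sup>(\<^sup>w\<^sup>)) \<le> 2 a w/b\<close> (\<open>integral_stationary_diff_le\<close>).  Integrability of \<open>1/\<phi>\<close> at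
  infinity makes \<open>v\<^sub>1\<close> bounded (\<open>v_1_bounded\<close>), so that \<open>w = vbar v 1 * exp (- b * (t - 1))\<close> is a valid
  choice for \<open>t \<ge> 1\<close>.

  The law \<open>Q\<close> has to be constructed, as only the semigroup with immigration is given
  (\<open>branching_law_exists\<close>).  Immigration at rate \<open>a\<close> is to first order a drift, so \<open>Q\<close> is the limit of
  chains that alternate between running \<open>P\<^sub>h\<close> and removing the mass \<open>a h\<close>.\<close>

section \<open>Laplace transforms of laws on the half-line\<close>

abbreviation prob_nonneg :: "real measure set" where
  "prob_nonneg \<equiv> space (prob_algebra borel_nonneg)"

definition laplace :: "real measure \<Rightarrow> real \<Rightarrow> real" where
  "laplace M l = (LINT y|M. exp (- l * y))"

lemma prob_nonnegD:
  assumes "M \<in> prob_nonneg"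
  shows "prob_space M" "sets M = sets borel_nonneg" "space M = {0..}"
  using assms sets_eq_imp_space_eq[of M borel_nonneg]
  by (auto simp: space_prob_algebra space_restrict_space)

lemma measurable_prob_nonneg:
  assumes "M \<in> prob_nonneg" "f \<in> borel_measurable borel_nonneg"
  shows "f \<in> borel_measurable M"
  using assms(2) prob_nonnegD(2)[OF assms(1)] measurable_cong_sets by blast

lemma integrable_prob_nonneg:
  fixes f :: "real \<Rightarrow> real"
  assumes "M \<in> prob_nonneg" "f \<in> borel_measurable borel_nonneg"
    and "\<And>x. x \<ge> 0 \<Longrightarrow> \<bar>f x\<bar> \<le> B"
  shows "integrable M f"
proof -
  interpret prob_space M by (rule prob_nonnegD[OF assms(1)])
  show ?thesis
    using assms prob_nonnegD[OF assms(1)]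
    by (intro integrable_const_bound[where B=B]) (auto simp: measurable_prob_nonneg)
qed

lemma integral_const_prob_nonneg:
  assumes "M \<in> prob_nonneg" shows "(LINT y|M. c::real) = c"
  using prob_space.prob_space[OF prob_nonnegD(1)[OF assms]] by simp

lemma abs_integral_le_prob_nonneg:
  fixes f :: "real \<Rightarrow> real"
  assumes "M \<in> prob_nonneg" "f \<in> borel_measurable borel_nonneg"
    and "\<And>x. x \<ge> 0 \<Longrightarrow> \<bar>f x\<bar> \<le> B"
  shows "\<bar>integral\<^sup>L M f\<bar> \<le> B"
proof -
  have "\<bar>integral\<^sup>L M f\<bar> \<le> (LINT y|M. \<bar>f y\<bar>)" by (rule integral_abs_bound)
  also have "\<dots> \<le> (LINT y|M. B)"
    using assms prob_nonnegD[OF assms(1)]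
    by (intro integral_mono integrable_prob_nonneg[where B=B]) 
       (auto intro: measurable_prob_nonneg order_trans[OF abs_ge_zero])
  finally show ?thesis unfolding integral_const_prob_nonneg[OF assms(1)] .
qed

lemma borel_nonneg_measurable: 
  "f \<in> borel_measurable borel \<Longrightarrow> f \<in> borel_measurable borel_nonneg"
  by (rule measurable_restrict_space1)

lemma integrable_exp_prob_nonneg:
  assumes "M \<in> prob_nonneg" "l \<ge> 0"
  shows "integrable M (\<lambda>y. exp (- l * y))"
  using assms by (intro integrable_prob_nonneg[where B=1]) (auto intro!: borel_nonneg_measurable)

text \<open>Under the substitution \<open>s = e\<^sup>-\<^sup>x\<close> the values \<open>laplace M k\<close>, \<open>k \<in> \<nat>\<close>, become
  the moments of a measure on \<open>[0, 1]\<close>, so they determine all integrals of polynomials and, by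
  Weierstrass approximation, of continuous functions of \<open>s\<close>.\<close>

lemma laplace_determines_continuous_integrals:
  assumes M: "M \<in> prob_nonneg" and N: "N \<in> prob_nonneg"
    and eq: "\<And>l. l \<ge> 0 \<Longrightarrow> laplace M l = laplace N l"
    and g: "continuous_on {0..1} g"
  shows "(LINT x|M. g (exp (- x))) = (LINT x|N. g (exp (- x)) :: real)"
proof -
  have poly_eq: "(LINT x|M. p (exp (- x))) = (LINT x|N. p (exp (- x)))"
    if p: "real_polynomial_function p" for p :: "real \<Rightarrow> real"
  proof -
    obtain c n where pc: "p = (\<lambda>x. \<Sum>i\<le>n. c i * x ^ i)"
      using real_polynomial_function_imp_sum[OF p] by blast
    have "(LINT x|K. p (exp (- x))) = (\<Sum>i\<le>n. c i * laplace K i)" if K: "K \<in> prob_nonneg" for K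
    proof -
      have "(LINT x|K. p (exp (- x))) = (LINT x|K. (\<Sum>i\<le>n. c i * exp (- real i * x)))"
        using exp_of_nat_mult[of _ "- x" for x :: real, symmetric] by (simp add: pc)
      also have "\<dots> = (\<Sum>i\<le>n. (LINT x|K. c i * exp (- real i * x)))"
        by (intro Bochner_Integration.integral_sum integrable_mult_right 
            integrable_exp_prob_nonneg[OF K]) simp
      finally show ?thesis by (simp add: laplace_def)
    qed
    thus ?thesis using M N eq by simp
  qed
  have meas: "(\<lambda>x. h (exp (- x))) \<in> borel_measurable borel_nonneg"
    if h: "continuous_on {0..1} h" for h :: "real \<Rightarrow> real"
  proof -
    have "continuous_on {0..} (\<lambda>x. h (exp (- x)))"
      by (intro continuous_on_compose2[OF h] continuous_intros) auto
    thus ?thesis using borel_measurable_continuous_on_restrict by blast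
  qed
  have "\<bar>(LINT x|M. g (exp (- x))) - (LINT x|N. g (exp (- x)))\<bar> \<le> 0 + d" if d: "d > 0" for d
  proof -
    define e where "e = d / 2"
    have e: "e > 0" using d by (simp add: e_def)
    obtain p where p: "real_polynomial_function p" 
      and pe: "\<And>s. s \<in> {0..1} \<Longrightarrow> \<bar>g s - p s\<bar> < e"
      using Stone_Weierstrass_real_polynomial_function[OF _ g e] by auto
    have cp: "continuous_on {0..1} p"
      using p continuous_on_polymonial_function real_polynomial_function_eq by blast
    have close: "\<bar>(LINT x|K. g (exp (- x))) - (LINT x|K. p (exp (- x)))\<bar> \<le> e"
      if K: "K \<in> prob_nonneg" for K
    proof -
      have bdd: "\<exists>B. \<forall>x\<ge>0. \<bar>h (exp (- x))\<bar> \<le> B" if h: "continuous_on {0..1} h" 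
        for h :: "real \<Rightarrow> real"
      proof -
        have "bounded (h ` {0..1})"
          by (intro compact_imp_bounded compact_continuous_image h compact_Icc)
        then obtain B where "\<forall>y\<in>h ` {0..1}. norm y \<le> B" unfolding bounded_iff by blast
        thus ?thesis by (intro exI[of _ B]) auto
      qed
      have int: "integrable K (\<lambda>x. h (exp (- x)))" if "continuous_on {0..1} h" 
        for h :: "real \<Rightarrow> real"
        using bdd[OF that] integrable_prob_nonneg[OF K meas[OF that]] by blast
      have "\<bar>LINT x|K. g (exp (- x)) - p (exp (- x))\<bar> \<le> e"
        using pe by (intro abs_integral_le_prob_nonneg[OF K] borel_measurable_diff meas g cp)
          (auto intro!: less_imp_le)
      thus ?thesis
        using Bochner_Integration.integral_diff[OF int[OF g] int[OF cp]] by simp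
    qed
    show ?thesis using close[OF M] close[OF N] poly_eq[OF p] unfolding e_def by linarith
  qed
  hence "\<bar>(LINT x|M. g (exp (- x))) - (LINT x|N. g (exp (- x)))\<bar> \<le> 0"
    by (rule field_le_epsilon)
  thus ?thesis by simp
qed

lemma real_distribution_extend:
  assumes "M \<in> prob_nonneg"
  shows "real_distribution (distr M borel (\<lambda>x. x))"
proof -
  interpret prob_space M by (rule prob_nonnegD[OF assms])
  show ?thesis
    by (rule real_distribution_distr[OF measurable_prob_nonneg[OF assms borel_nonneg_measurable]]) simp
qed

theorem laplace_inject:
  assumes M: "M \<in> prob_nonneg" and N: "N \<in> prob_nonneg"
    and eq: "\<And>l. l \<ge> 0 \<Longrightarrow> laplace M l = laplace N l"
  shows "M = N"
proof -
  have meas_le: "measure M {x \<in> {0..}. x \<le> c} = measure N {x \<in> {0..}. x \<le> c}" for c :: real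
  proof -
    \<comment> \<open>Continuous ramps in \<open>s = e\<^sup>-\<^sup>x\<close> decreasing to the indicator of \<open>s \<ge> e\<^sup>-\<^sup>c\<close>, that is of
      \<open>x \<le> c\<close>.\<close>
    define g where "g k s = min 1 (max 0 (1 + real k * (s - exp (- c))))" for k :: nat and s :: real
    have cont: "continuous_on A (g k)" for k A
      unfolding g_def by (intro continuous_intros)
    have lim: "(\<lambda>k. g k (exp (- x))) \<longlonglongrightarrow> indicator {x. x \<le> c} x" for x
    proof (cases "x \<le> c")
      case True
      hence "real k * (exp (- x) - exp (- c)) \<ge> 0" for k by simp
      hence "g k (exp (- x)) = 1" for k unfolding g_def by (smt (verit, best))
      thus ?thesis using True by simp
    next
      case False
      hence d: "exp (- c) - exp (- x) > 0" by simp
      have "eventually (\<lambda>k. g k (exp (- x)) = 0) sequentially"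
      proof -
        obtain K where K: "real K * (exp (- c) - exp (- x)) > 1"
          using ex_less_of_nat_mult[OF d] by auto
        show ?thesis
        proof (rule eventually_sequentiallyI[of K])
          fix k assume "K \<le> k"
          hence "real K * (exp (- c) - exp (- x)) \<le> real k * (exp (- c) - exp (- x))"
            using d by (intro mult_right_mono) auto
          with K have "1 + real k * (exp (- x) - exp (- c)) \<le> 0" by (simp add: algebra_simps)
          thus "g k (exp (- x)) = 0" unfolding g_def by linarith
        qed
      qed
      thus ?thesis using False by (simp add: tendsto_eventually)
    qed
    have conv: "(\<lambda>k. LINT x|K. g k (exp (- x))) \<longlonglongrightarrow> measure K {x \<in> {0..}. x \<le> c}" 
      if K: "K \<in> prob_nonneg" for K
    proof -
      interpret prob_space K by (rule prob_nonnegD[OF K])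
      have m: "(\<lambda>x. g k (exp (- x))) \<in> borel_measurable K" for k
        unfolding g_def by (intro measurable_prob_nonneg[OF K] borel_nonneg_measurable) simp
      have "(\<lambda>k. LINT x|K. g k (exp (- x))) \<longlonglongrightarrow> (LINT x|K. indicator {x. x \<le> c} x)"
        by (rule integral_dominated_convergence[where w="\<lambda>_. 1"])
           (auto intro!: m lim measurable_prob_nonneg[OF K] borel_nonneg_measurable, simp add: g_def)
      thus ?thesis by (simp add: prob_nonnegD(3)[OF K] Int_def conj_commute)
    qed
    have "(\<lambda>k. LINT x|M. g k (exp (- x))) = (\<lambda>k. LINT x|N. g k (exp (- x)))"
      by (intro ext laplace_determines_continuous_integrals[OF M N eq cont])
    with conv[OF M] have "(\<lambda>k. LINT x|N. g k (exp (- x))) \<longlonglongrightarrow> measure M {x \<in> {0..}. x \<le> c}" 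
      by simp
    thus ?thesis using conv[OF N] by (rule LIMSEQ_unique)
  qed
  have "cdf (distr M borel (\<lambda>x. x)) = cdf (distr N borel (\<lambda>x. x))"
  proof
    fix c
    have "cdf (distr K borel (\<lambda>x. x)) c = measure K {x \<in> {0..}. x \<le> c}" 
      if K: "K \<in> prob_nonneg" for K
      unfolding cdf_def
      by (subst measure_distr) (auto intro!: measurable_prob_nonneg[OF K] borel_nonneg_measurable arg_cong[where f="measure K"]
          simp: prob_nonnegD(3)[OF K])
    thus "cdf (distr M borel (\<lambda>x. x)) c = cdf (distr N borel (\<lambda>x. x)) c"
      using M N meas_le by simp
  qed
  hence "distr M borel (\<lambda>x. x) = distr N borel (\<lambda>x. x)"
    using cdf_unique real_distribution_extend M N by blast
  moreover have restrict_back: "K = restrict_space (distr K borel (\<lambda>x. x)) {0..}" if K: "K \<in> prob_nonneg" for K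
  proof (rule measure_eqI)
    show "sets K = sets (restrict_space (distr K borel (\<lambda>x. x)) {0..})"
      by (simp add: prob_nonnegD(2)[OF K] sets_restrict_space)
    fix A assume "A \<in> sets K"
    hence A: "A \<subseteq> {0..}" "A \<in> sets borel"
      by (auto simp: prob_nonnegD(2)[OF K] sets_restrict_space_iff)
    thus "emeasure K A = emeasure (restrict_space (distr K borel (\<lambda>x. x)) {0..}) A"
      by (subst emeasure_restrict_space; (subst emeasure_distr)?) 
         (auto intro!: measurable_prob_nonneg[OF K] borel_nonneg_measurable arg_cong[where f="emeasure K"]
           simp: prob_nonnegD(3)[OF K])
  qed
  ultimately show ?thesis by (subst restrict_back[OF M], subst restrict_back[OF N]) simp
qed

text \<open>A lower bound \<open>e\<^sup>-\<^sup>C\<^sup>l\<close> near \<open>l = 0\<close> keeps mass from escaping to infinity: mass beyond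
  \<open>1/l\<close> costs the transform at least \<open>1 - e\<^sup>-\<^sup>1\<close> of that mass.  So the sequence is tight, and
  Helly selection produces the limit law.\<close>

theorem laplace_continuity:
  assumes M: "\<And>n. M n \<in> prob_nonneg"
    and lim: "\<And>l. l \<ge> 0 \<Longrightarrow> (\<lambda>n. laplace (M n) l) \<longlonglongrightarrow> L l"
    and C: "C \<ge> 0" "\<And>n l. l \<ge> 0 \<Longrightarrow> laplace (M n) l \<ge> exp (- C * l)"
  obtains N where "N \<in> prob_nonneg" "\<And>l. l \<ge> 0 \<Longrightarrow> laplace N l = L l"
proof -
  define D where "D n = distr (M n) borel (\<lambda>x. x)" for n
  have D: "real_distribution (D n)" for n
    unfolding D_def by (rule real_distribution_extend[OF M])
  have idm: "(\<lambda>x. x) \<in> borel_measurable (M n)" for n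
    by (intro measurable_prob_nonneg[OF M] borel_nonneg_measurable) simp
  have tail: "measure (M n) {x \<in> {0..}. x > 1 / l} \<le> 2 * C * l" if l: "l > 0" for n l
  proof -
    interpret prob_space "M n" by (rule prob_nonnegD[OF M])
    have set: "{x \<in> {0..}. x > 1 / l} \<in> sets (M n)"
      by (auto simp: prob_nonnegD(2)[OF M] sets_restrict_space_iff)
    have "(1 - exp (-1)) * measure (M n) {x \<in> {0..}. x > 1 / l}
        = (LINT x|M n. (1 - exp (-1)) * indicator {x \<in> {0..}. x > 1 / l} x)"
      using sets.sets_into_space[OF set] by (simp add: Int_absorb2 del: Int_Collect)
    also have "\<dots> \<le> (LINT x|M n. 1 - exp (- l * x))"
    proof (rule integral_mono)
      show "integrable (M n) (\<lambda>x. (1 - exp (-1)) * indicator {x \<in> {0..}. x > 1 / l} x :: real)"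
        using set by (intro integrable_mult_right) (simp add: emeasure_eq_measure)
      show "integrable (M n) (\<lambda>x. 1 - exp (- l * x))"
        using l by (intro Bochner_Integration.integrable_diff integrable_exp_prob_nonneg[OF M]) auto
      fix x assume "x \<in> space (M n)"
      hence "x \<ge> 0" by (simp add: prob_nonnegD(3)[OF M])
      thus "(1 - exp (-1)) * indicator {x \<in> {0..}. x > 1 / l} x \<le> 1 - exp (- l * x)"
        using l by (cases "x > 1 / l") (auto simp: pos_divide_less_eq mult.commute)
    qed
    also have "\<dots> = 1 - laplace (M n) l"
      unfolding laplace_def using l integrable_exp_prob_nonneg[OF M, of l n]
      by (subst Bochner_Integration.integral_diff) (auto simp: prob_space)
    also have "\<dots> \<le> 1 - exp (- C * l)" using C(2)[of l n] l by simp
    also have "\<dots> \<le> C * l" using exp_ge_add_one_self[of "- C * l"] by simp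
    finally have "(1 - exp (-1)) * measure (M n) {x \<in> {0..}. x > 1 / l} \<le> C * l" .
    moreover have "1 / 2 \<le> 1 - exp (-1::real)"
      using exp_ge_add_one_self[of "1::real"] by (simp add: exp_minus field_simps)
    hence "1 / 2 * measure (M n) {x \<in> {0..}. x > 1 / l} 
        \<le> (1 - exp (-1)) * measure (M n) {x \<in> {0..}. x > 1 / l}"
      by (intro mult_right_mono) auto
    ultimately show ?thesis by linarith
  qed
  have "tight D"
    unfolding tight_def
  proof (intro conjI allI impI D)
    fix \<epsilon> :: real assume e: "\<epsilon> > 0"
    define l where "l = \<epsilon> / (4 * C + 4)"
    have l: "l > 0" using e C by (simp add: l_def)
    have "2 * C * l = \<epsilon> * (2 * C / (4 * C + 4))" by (simp add: l_def)
    also have "\<dots> < \<epsilon> * 1"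
      by (intro mult_strict_left_mono e) (use C in simp)
    finally have "2 * C * l < \<epsilon>" by simp
    have "1 - \<epsilon> < measure (D n) {-1<..1 / l}" for n
    proof -
      interpret prob_space "M n" by (rule prob_nonnegD[OF M])
      have set: "{x \<in> {0..}. x > 1 / l} \<in> sets (M n)"
        by (auto simp: prob_nonnegD(2)[OF M] sets_restrict_space_iff)
      have "measure (D n) {-1<..1 / l} = measure (M n) (space (M n) - {x \<in> {0..}. x > 1 / l})"
        unfolding D_def
        by (subst measure_distr) (auto intro!: idm arg_cong[where f="measure (M n)"] 
            simp: prob_nonnegD(3)[OF M])
      also have "\<dots> = 1 - measure (M n) {x \<in> {0..}. x > 1 / l}" by (rule prob_compl[OF set])
      finally show ?thesis using tail[OF l, of n] \<open>2 * C * l < \<epsilon>\<close> by linarith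
    qed
    thus "\<exists>a b. a < b \<and> (\<forall>n. 1 - \<epsilon> < measure (D n) {a<..b})"
      using l by (intro exI[of _ "-1"] exI[of _ "1 / l"]) (auto intro: less_trans[of _ 0])
  qed
  from tight_imp_convergent_subsubsequence[OF this strict_mono_id]
  obtain r K where r: "strict_mono r" and K: "real_distribution K" 
    and wc: "weak_conv_m (D \<circ> id \<circ> r) K" by blast
  interpret K: real_distribution K by (rule K)
  have wint: "(\<lambda>n. LINT x|D (r n). f x) \<longlonglongrightarrow> (LINT x|K. f x)"
    if "\<And>x. isCont f x" "\<And>x. norm (f x) \<le> 1" for f :: "real \<Rightarrow> real"
    using weak_conv_imp_integral_bdd_continuous_conv[OF _ K wc that] D by (simp add: comp_def)
  have intD: "(LINT x|D n. f x) = (LINT x|M n. f x)" if "f \<in> borel_measurable borel" 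
    for f :: "real \<Rightarrow> real" and n
    unfolding D_def by (rule integral_distr[OF idm that])
  have K0: "AE x in K. x \<ge> 0"
  proof -
    define f where "f x = min 1 (max 0 (- x))" for x :: real
    have f: "f \<in> borel_measurable borel" unfolding f_def by simp
    have "(LINT x|M n. f x) = 0" for n
      by (intro integral_eq_zero_AE AE_I2) (simp add: f_def prob_nonnegD(3)[OF M])
    hence "(\<lambda>n. LINT x|D (r n). f x) \<longlonglongrightarrow> 0" using intD[OF f] by simp
    moreover have "(\<lambda>n. LINT x|D (r n). f x) \<longlonglongrightarrow> (LINT x|K. f x)"
      by (rule wint) (auto simp: f_def intro!: continuous_intros)
    ultimately have "(LINT x|K. f x) = 0" using LIMSEQ_unique by blast
    moreover have "integrable K f"
      by (rule K.integrable_const_bound[where B=1]) (use f in \<open>auto simp: f_def\<close>)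
    moreover have "AE x in K. 0 \<le> f x" by (simp add: f_def)
    ultimately have "AE x in K. f x = 0" using integral_nonneg_eq_0_iff_AE by blast
    thus ?thesis by (rule AE_mp) (auto simp: f_def min_def max_def split: if_splits)
  qed
  define N where "N = restrict_space K {0..}"
  have N: "N \<in> prob_nonneg"
  proof -
    have "emeasure K {0..} = 1" 
      using K0 by (subst K.emeasure_eq_1_AE) auto
    hence "prob_space N" 
      unfolding N_def by (intro prob_spaceI) (simp add: emeasure_restrict_space space_restrict_space)
    moreover have "sets N = sets borel_nonneg"
      unfolding N_def by (rule sets_restrict_space_cong) simp
    ultimately show ?thesis by (simp add: space_prob_algebra)
  qed
  moreover have "laplace N l = L l" if l: "l \<ge> 0" for l
  proof -
    define f where "f x = exp (- l * max 0 x)" for x :: real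
    have f: "f \<in> borel_measurable borel" unfolding f_def by simp
    have "(LINT x|M n. f x) = laplace (M n) l" for n
      unfolding laplace_def 
      by (intro Bochner_Integration.integral_cong) (auto simp: f_def prob_nonnegD(3)[OF M])
    moreover have "(\<lambda>n. LINT x|D (r n). f x) \<longlonglongrightarrow> (LINT x|K. f x)"
      by (rule wint) (use l in \<open>auto simp: f_def intro!: continuous_intros\<close>)
    moreover have "(\<lambda>n. laplace (M (r n)) l) \<longlonglongrightarrow> L l"
      using LIMSEQ_subseq_LIMSEQ[OF lim[OF l] r] by (simp add: comp_def)
    ultimately have "L l = (LINT x|K. f x)" using LIMSEQ_unique intD[OF f] by simp
    also have "\<dots> = (LINT x|K. indicator {0..} x *\<^sub>R exp (- l * x))"
    proof (rule integral_cong_AE)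
      show "AE x in K. f x = indicator {0..} x *\<^sub>R exp (- l * x)"
        using K0 by (rule eventually_mono) (simp add: f_def)
    qed (use f in simp_all)
    also have "\<dots> = laplace N l"
      unfolding laplace_def N_def by (subst integral_restrict_space) auto
    finally show ?thesis by simp
  qed
  ultimately show thesis using that by blast
qed

section \<open>Kernels and convolution on the half-line\<close>

lemma bind_prob_nonneg:
  assumes "M \<in> prob_nonneg" "K \<in> borel_nonneg \<rightarrow>\<^sub>M prob_algebra borel_nonneg"
  shows "M \<bind> K \<in> prob_nonneg"
  using prob_space_bind'[OF assms] sets_bind'[OF assms] by (simp add: space_prob_algebra)

lemma kernel_prob_nonneg:
  assumes "K \<in> borel_nonneg \<rightarrow>\<^sub>M prob_algebra borel_nonneg" "x \<ge> 0"
  shows "K x \<in> prob_nonneg"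
  using measurable_space[OF assms(1), of x] assms(2) by (simp add: space_restrict_space)

lemma integral_kernel_measurable:
  fixes f :: "real \<Rightarrow> real"
  assumes "K \<in> borel_nonneg \<rightarrow>\<^sub>M prob_algebra borel_nonneg" "f \<in> borel_measurable borel_nonneg"
  shows "(\<lambda>x. integral\<^sup>L (K x) f) \<in> borel_measurable borel_nonneg"
  by (rule measurable_compose[OF measurable_prob_algebraD[OF assms(1)] 
        integral_measurable_subprob_algebra[OF assms(2)]])

lemma integral_bind_prob_nonneg:
  fixes f :: "real \<Rightarrow> real"
  assumes M: "M \<in> prob_nonneg" and K: "K \<in> borel_nonneg \<rightarrow>\<^sub>M prob_algebra borel_nonneg"
    and f: "f \<in> borel_measurable borel_nonneg" "\<And>x. x \<ge> 0 \<Longrightarrow> \<bar>f x\<bar> \<le> B"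
  shows "integral\<^sup>L (M \<bind> K) f = (LINT x|M. integral\<^sup>L (K x) f)"
proof (rule integral_bind[OF f(1), where B=B and B'=1])
  interpret prob_space M by (rule prob_nonnegD[OF M])
  show "finite_measure M" by (rule finite_measure_axioms)
  show "K \<in> M \<rightarrow>\<^sub>M subprob_algebra borel_nonneg"
    using measurable_prob_algebraD[OF K] measurable_cong_sets[OF prob_nonnegD(2)[OF M] refl] by blast
  show "\<bar>f x\<bar> \<le> B" if "x \<in> space borel_nonneg" for x
    using that f(2) by (simp add: space_restrict_space)
  have "emeasure (K x) (space (K x)) = 1" if "x \<in> space M" for x
    using that prob_space.emeasure_space_1[OF prob_nonnegD(1)[OF kernel_prob_nonneg[OF K]]] 
    by (simp add: prob_nonnegD(3)[OF M])
  thus "AE x in M. emeasure (K x) (space (K x)) \<le> ennreal 1" by (intro AE_I2) simp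
qed

lemma exp_measurable_nonneg: "(\<lambda>y::real. exp (- l * y)) \<in> borel_measurable borel_nonneg"
  by (rule borel_nonneg_measurable) simp

lemma laplace_bind:
  assumes "M \<in> prob_nonneg" "K \<in> borel_nonneg \<rightarrow>\<^sub>M prob_algebra borel_nonneg" "l \<ge> 0"
  shows "laplace (M \<bind> K) l = (LINT x|M. laplace (K x) l)"
  unfolding laplace_def
  by (rule integral_bind_prob_nonneg[OF assms(1,2) exp_measurable_nonneg, where B=1])
     (use assms(3) in auto)

lemma laplace_bounds:
  assumes "M \<in> prob_nonneg" "l \<ge> 0"
  shows "0 \<le> laplace M l" "laplace M l \<le> 1"
proof -
  show "0 \<le> laplace M l" unfolding laplace_def by (intro Bochner_Integration.integral_nonneg) simp
  have "\<bar>laplace M l\<bar> \<le> 1" unfolding laplace_def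
    using assms by (intro abs_integral_le_prob_nonneg exp_measurable_nonneg) auto
  thus "laplace M l \<le> 1" by simp
qed

lemma return_prob_nonneg: "x \<ge> 0 \<Longrightarrow> return borel_nonneg x \<in> prob_nonneg"
  by (simp add: space_prob_algebra prob_space_return space_restrict_space)

lemma laplace_return: "x \<ge> 0 \<Longrightarrow> laplace (return borel_nonneg x) l = exp (- l * x)"
  unfolding laplace_def
  by (rule integral_return[OF _ exp_measurable_nonneg]) (simp add: space_restrict_space)

text \<open>Convolution with \<open>M\<close>, as a kernel.\<close>

definition shift_kernel :: "real measure \<Rightarrow> real \<Rightarrow> real measure" where
  "shift_kernel M y = distr M borel_nonneg (\<lambda>z. y + z)"

lemma measurable_add_nonneg: 
  assumes "y \<ge> 0" shows "(\<lambda>z. y + z) \<in> borel_nonneg \<rightarrow>\<^sub>M borel_nonneg"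
  by (rule measurable_restrict_space3) (use assms in auto)

lemma shift_kernel_measurable:
  assumes "M \<in> prob_nonneg"
  shows "shift_kernel M \<in> borel_nonneg \<rightarrow>\<^sub>M prob_algebra borel_nonneg"
  unfolding shift_kernel_def[abs_def]
proof (rule measurable_distr_prob_space2[where M=borel_nonneg])
  show "(\<lambda>x. M) \<in> borel_nonneg \<rightarrow>\<^sub>M prob_algebra borel_nonneg"
    using assms by (intro measurable_const)
  have "(\<lambda>p. p) \<in> borel_nonneg \<Otimes>\<^sub>M borel_nonneg \<rightarrow>\<^sub>M borel \<Otimes>\<^sub>M (borel :: real measure)"
    using measurable_compose[OF measurable_fst borel_nonneg_measurable[OF measurable_ident]]
      measurable_compose[OF measurable_snd borel_nonneg_measurable[OF measurable_ident]]
    by (intro measurable_pair) (simp_all add: comp_def id_def)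
  from measurable_compose[OF this, of "\<lambda>(y, z). y + z" borel]
  show "(\<lambda>(y, z). y + z) \<in> borel_nonneg \<Otimes>\<^sub>M borel_nonneg \<rightarrow>\<^sub>M borel_nonneg"
    by (intro measurable_restrict_space2) (auto simp: space_pair_measure space_restrict_space)
qed

lemma integral_shift_kernel:
  fixes f :: "real \<Rightarrow> real"
  assumes M: "M \<in> prob_nonneg" and y: "y \<ge> 0" and f: "f \<in> borel_measurable borel_nonneg"
  shows "integral\<^sup>L (shift_kernel M y) f = (LINT z|M. f (y + z))"
  unfolding shift_kernel_def
  using measurable_add_nonneg[OF y] measurable_cong_sets[OF prob_nonnegD(2)[OF M] refl]
  by (intro integral_distr f) blast

lemma laplace_shift_kernel:
  assumes "M \<in> prob_nonneg" "y \<ge> 0"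
  shows "laplace (shift_kernel M y) l = exp (- l * y) * laplace M l"
proof -
  have "laplace (shift_kernel M y) l = (LINT z|M. exp (- l * y) * exp (- l * z))"
    unfolding laplace_def integral_shift_kernel[OF assms exp_measurable_nonneg]
    by (simp add: exp_add[symmetric] algebra_simps)
  thus ?thesis by (simp add: laplace_def)
qed

text \<open>The transform tends to the mass at \<open>0\<close> as \<open>l \<rightarrow> \<infinity>\<close>, so a lower bound for the transform is one
  for this mass.\<close>

lemma measure_pos_le:
  assumes M: "M \<in> prob_nonneg" and c: "\<And>l. l \<ge> 0 \<Longrightarrow> c \<le> laplace M l"
  shows "measure M {0<..} \<le> 1 - c"
proof -
  interpret prob_space M by (rule prob_nonnegD[OF M])
  have set: "{0<..} \<in> sets M" 
    by (auto simp: prob_nonnegD(2)[OF M] sets_restrict_space_iff)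
  have "(\<lambda>n. LINT x|M. 1 - exp (- real n * x)) \<longlonglongrightarrow> (LINT x|M. indicator {0<..} x)"
  proof (rule integral_dominated_convergence[where w="\<lambda>_. 1"])
    show "AE x in M. (\<lambda>n. 1 - exp (- real n * x)) \<longlonglongrightarrow> indicator {0<..} x"
    proof (rule AE_I2)
      fix x assume "x \<in> space M"
      hence x: "x \<ge> 0" by (simp add: prob_nonnegD(3)[OF M])
      show "(\<lambda>n. 1 - exp (- real n * x)) \<longlonglongrightarrow> indicator {0<..} x"
      proof (cases "x = 0")
        case False
        hence "exp (- x) < 1" "0 \<le> exp (- x)" using x by auto
        hence "(\<lambda>n. 1 - exp (- x) ^ n) \<longlonglongrightarrow> 1 - 0"
          by (intro tendsto_diff tendsto_const LIMSEQ_realpow_zero)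
        thus ?thesis using False x exp_of_nat_mult[of _ "- x", symmetric] by simp
      qed simp
    qed
    show "AE x in M. norm (1 - exp (- real n * x)) \<le> 1" for n
      by (rule AE_I2) (simp add: prob_nonnegD(3)[OF M])
  qed (use set in \<open>auto intro!: measurable_prob_nonneg[OF M] borel_nonneg_measurable\<close>)
  moreover have "(LINT x|M. 1 - exp (- real n * x)) \<le> 1 - c" for n
    using c[of n] integrable_exp_prob_nonneg[OF M, of n]
    by (subst Bochner_Integration.integral_diff) (auto simp: laplace_def prob_space)
  ultimately have "(LINT x|M. indicator {0<..} x) \<le> 1 - c"
    by (intro LIMSEQ_le_const2) auto
  thus ?thesis using set sets.sets_into_space[OF set] by (simp add: Int_absorb2)
qed

section \<open>Branching mechanisms\<close>

text \<open>The increment is bounded by \<open>(z - w) u\<close>, which is good for large \<open>u\<close>, and by \<open>(z - w) z u\<^sup>2\<close>,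
  which is good for small \<open>u\<close>; together they give a multiple of the function \<open>min u u\<^sup>2\<close> that a Levy
  measure integrates.\<close>

lemma exp_taylor_remainder_increment:
  fixes z w u :: real
  assumes "0 \<le> w" "w \<le> z" "u \<ge> 0"
  shows "exp (- w * u) - 1 + w * u \<le> exp (- z * u) - 1 + z * u"
    and "(exp (- z * u) - 1 + z * u) - (exp (- w * u) - 1 + w * u) \<le> (z - w) * ((1 + z) * min u (u\<^sup>2))"
proof -
  have d: "(z - w) * u \<ge> 0" using assms by simp
  have "exp (- w * u) - exp (- z * u) = exp (- w * u) * (1 - exp (- ((z - w) * u)))"
    by (simp add: algebra_simps exp_add[symmetric])
  also have "\<dots> \<le> 1 * ((z - w) * u)"
    using exp_ge_add_one_self[of "- ((z - w) * u)"] assms d by (intro mult_mono) auto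
  finally show "exp (- w * u) - 1 + w * u \<le> exp (- z * u) - 1 + z * u"
    by (simp add: algebra_simps)
  have "exp (- z * u) \<le> exp (- w * u)" using assms by (simp add: mult_right_mono)
  hence 1: "(exp (- z * u) - 1 + z * u) - (exp (- w * u) - 1 + w * u) \<le> (z - w) * u"
    by (simp add: algebra_simps)
  have "exp (- w * u) - exp (- z * u) = exp (- z * u) * (exp ((z - w) * u) - 1)"
    by (simp add: algebra_simps exp_add[symmetric])
  also have "\<dots> \<ge> (1 - z * u) * ((z - w) * u)"
  proof -
    have "exp (- z * u) \<ge> 1 - z * u" using exp_ge_add_one_self[of "- z * u"] by simp
    hence "(1 - z * u) * ((z - w) * u) \<le> exp (- z * u) * ((z - w) * u)"
      using d by (intro mult_right_mono)
    also have "\<dots> \<le> exp (- z * u) * (exp ((z - w) * u) - 1)"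
      by (intro mult_left_mono) (use exp_ge_add_one_self[of "(z - w) * u"] in linarith, simp)
    finally show ?thesis .
  qed
  finally have 2: "(exp (- z * u) - 1 + z * u) - (exp (- w * u) - 1 + w * u) \<le> (z - w) * (z * u\<^sup>2)"
    by (simp add: algebra_simps power2_eq_square)
  have "u \<le> (1 + z) * u" "z * u\<^sup>2 \<le> (1 + z) * u\<^sup>2"
    using assms by (auto simp: distrib_right)
  hence "(z - w) * u \<le> (z - w) * ((1 + z) * u)" "(z - w) * (z * u\<^sup>2) \<le> (z - w) * ((1 + z) * u\<^sup>2)"
    using assms by (auto intro!: mult_left_mono)
  thus "(exp (- z * u) - 1 + z * u) - (exp (- w * u) - 1 + w * u) \<le> (z - w) * ((1 + z) * min u (u\<^sup>2))"
    using 1 2 by (auto simp: min_def)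
qed

text \<open>The lower bound on increments orders the solutions of \<open>u' = -\<phi>(u)\<close> and gives the decay rate
  \<open>b\<close>; the upper one gives continuity of \<open>\<phi>\<close> and keeps positive solutions positive.\<close>

locale monotone_mechanism =
  fixes b :: real and \<phi> :: "real \<Rightarrow> real"
  assumes b_pos: "b > 0"
    and phi_0: "\<phi> 0 = 0"
    and phi_increment: "\<And>w z. 0 \<le> w \<Longrightarrow> w \<le> z \<Longrightarrow> b * (z - w) \<le> \<phi> z - \<phi> w"
    and phi_lipschitz: "\<And>K. \<exists>C. \<forall>w z. 0 \<le> w \<longrightarrow> w \<le> z \<longrightarrow> z \<le> K \<longrightarrow> \<phi> z - \<phi> w \<le> C * (z - w)"

lemma levy_measure_integrable:
  assumes "levy_measure m"
  shows "integrable m (\<lambda>u. min u (u\<^sup>2))"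
proof -
  have sets: "sets m = sets (restrict_space borel {0<..})" 
    and fin: "finite_measure (density m (\<lambda>u. ennreal (min u (u\<^sup>2))))"
    using assms by (auto simp: levy_measure_def)
  have sp: "space m = {0<..}"
    using sets_eq_imp_space_eq[OF sets] by (simp add: space_restrict_space)
  have meas: "(\<lambda>u. min u (u\<^sup>2)) \<in> borel_measurable m"
    unfolding measurable_cong_sets[OF sets refl] by (rule measurable_restrict_space1) simp
  have "(\<integral>\<^sup>+u. ennreal (min u (u\<^sup>2)) \<partial>m) = emeasure (density m (\<lambda>u. ennreal (min u (u\<^sup>2)))) (space m)"
    using meas by (subst emeasure_density) (auto intro!: nn_integral_cong)
  also have "\<dots> < \<infinity>"
    using finite_measure.emeasure_finite[OF fin] by (simp add: less_top)
  finally show ?thesis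
    using meas by (intro integrableI_nonneg) (auto intro!: AE_I2 simp: sp)
qed

lemma branching_mechanism_monotone:
  assumes m: "levy_measure m" and b: "b > 0"
  shows "monotone_mechanism b (branching_mechanism b \<sigma> m)"
proof
  have sets: "sets m = sets (restrict_space borel {0<..})" 
    using m by (simp add: levy_measure_def)
  have sp: "space m = {0<..}"
    using sets_eq_imp_space_eq[OF sets] by (simp add: space_restrict_space)
  note int = levy_measure_integrable[OF m]
  define j where "j z u = exp (- z * u) - 1 + z * u" for z u :: real
  have meas: "j z \<in> borel_measurable m" for z
    unfolding measurable_cong_sets[OF sets refl] j_def by (rule measurable_restrict_space1) simp
  have j_int: "integrable m (j z)" if "z \<ge> 0" for z
  proof (rule Bochner_Integration.integrable_bound)
    show "integrable m (\<lambda>u. (z * (1 + z)) * min u (u\<^sup>2))" using int by simp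
    show "AE u in m. norm (j z u) \<le> norm ((z * (1 + z)) * min u (u\<^sup>2))"
    proof (rule AE_I2)
      fix u assume "u \<in> space m"
      hence "u > 0" by (simp add: sp)
      thus "norm (j z u) \<le> norm ((z * (1 + z)) * min u (u\<^sup>2))"
        using exp_taylor_remainder_increment[of 0 z u] that
        by (simp add: j_def mult.assoc)
    qed
  qed (rule meas)
  define J where "J z = (LINT u|m. j z u)" for z
  have bm: "branching_mechanism b \<sigma> m z = b * z + 1/2 * \<sigma>\<^sup>2 * z\<^sup>2 + J z" for z
    by (simp add: branching_mechanism_def J_def j_def)
  have J_mono: "J w \<le> J z" if "0 \<le> w" "w \<le> z" for w z
    unfolding J_def
  proof (rule integral_mono)
    fix u assume "u \<in> space m"
    thus "j w u \<le> j z u"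
      unfolding j_def using that by (intro exp_taylor_remainder_increment(1)) (auto simp: sp)
  qed (use that j_int in auto)
  define A where "A = (LINT u|m. min u (u\<^sup>2))"
  have A: "A \<ge> 0" unfolding A_def by (intro Bochner_Integration.integral_nonneg) (simp add: sp)
  have J_lip: "J z - J w \<le> (z - w) * ((1 + z) * A)" if "0 \<le> w" "w \<le> z" for w z
  proof -
    have "J z - J w = (LINT u|m. j z u - j w u)"
      unfolding J_def using that by (intro Bochner_Integration.integral_diff[symmetric] j_int) auto
    also have "\<dots> \<le> (LINT u|m. (z - w) * ((1 + z) * min u (u\<^sup>2)))"
      using that int unfolding j_def
      by (intro integral_mono Bochner_Integration.integrable_diff j_int[unfolded j_def] 
          integrable_mult_right exp_taylor_remainder_increment(2)) (auto simp: sp)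
    finally show ?thesis by (simp add: A_def)
  qed
  show "b > 0" by (rule b)
  show "branching_mechanism b \<sigma> m 0 = 0" by (simp add: branching_mechanism_def)
  show "b * (z - w) \<le> branching_mechanism b \<sigma> m z - branching_mechanism b \<sigma> m w"
    if "0 \<le> w" "w \<le> z" for w z
  proof -
    have "\<sigma>\<^sup>2 * w\<^sup>2 \<le> \<sigma>\<^sup>2 * z\<^sup>2" using that by (intro mult_left_mono power_mono) auto
    thus ?thesis using J_mono[OF that] by (simp add: bm algebra_simps)
  qed
  show "\<exists>C. \<forall>w z. 0 \<le> w \<longrightarrow> w \<le> z \<longrightarrow> z \<le> K \<longrightarrow>
      branching_mechanism b \<sigma> m z - branching_mechanism b \<sigma> m w \<le> C * (z - w)" for K
  proof (intro exI allI impI)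
    fix w z :: real assume wz: "0 \<le> w" "w \<le> z" "z \<le> K"
    have "\<sigma>\<^sup>2 * z\<^sup>2 - \<sigma>\<^sup>2 * w\<^sup>2 = \<sigma>\<^sup>2 * (z + w) * (z - w)" 
      by (simp add: algebra_simps power2_eq_square)
    also have "\<dots> \<le> \<sigma>\<^sup>2 * (2 * K) * (z - w)"
      using wz by (intro mult_right_mono mult_left_mono) auto
    finally have "1/2 * \<sigma>\<^sup>2 * z\<^sup>2 - 1/2 * \<sigma>\<^sup>2 * w\<^sup>2 \<le> \<sigma>\<^sup>2 * K * (z - w)" by simp
    moreover have "(z - w) * ((1 + z) * A) \<le> (z - w) * ((1 + K) * A)"
      using wz A by (intro mult_left_mono mult_right_mono) auto
    ultimately show "branching_mechanism b \<sigma> m z - branching_mechanism b \<sigma> m w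
        \<le> (b + \<sigma>\<^sup>2 * K + (1 + K) * A) * (z - w)"
      using J_lip[OF wz(1,2)] by (simp add: bm algebra_simps)
  qed
qed

context monotone_mechanism
begin

lemma phi_ge: "z \<ge> 0 \<Longrightarrow> b * z \<le> \<phi> z"
  using phi_increment[of 0 z] phi_0 by simp

lemma phi_pos: "z > 0 \<Longrightarrow> \<phi> z > 0"
  using phi_ge[of z] b_pos mult_pos_pos[of b z] by linarith

lemma phi_mono: "0 \<le> w \<Longrightarrow> w \<le> z \<Longrightarrow> \<phi> w \<le> \<phi> z"
  using phi_increment[of w z] b_pos mult_nonneg_nonneg[of b "z - w"] by linarith

lemma continuous_on_phi: "continuous_on {0..} \<phi>"
proof -
  have "continuous (at z within {0..}) \<phi>" if z: "z \<ge> 0" for z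
  proof -
    obtain C where C: "\<And>w y. 0 \<le> w \<Longrightarrow> w \<le> y \<Longrightarrow> y \<le> z + 1 \<Longrightarrow> \<phi> y - \<phi> w \<le> C * (y - w)"
      using phi_lipschitz[of "z + 1"] by blast
    have bound: "\<bar>\<phi> y - \<phi> z\<bar> \<le> \<bar>C\<bar> * \<bar>y - z\<bar>" if y: "0 \<le> y" "y \<le> z + 1" for y
    proof (cases "y \<le> z")
      case True
      have "\<phi> z - \<phi> y \<le> C * (z - y)" using C[of y z] y True by simp
      also have "\<dots> \<le> \<bar>C\<bar> * (z - y)" using True by (intro mult_right_mono) auto
      finally show ?thesis using True phi_mono[OF y(1) True] by simp
    next
      case False
      have "\<phi> y - \<phi> z \<le> C * (y - z)" using C[of z y] y z False by simp
      also have "\<dots> \<le> \<bar>C\<bar> * (y - z)" using False by (intro mult_right_mono) auto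
      finally show ?thesis using False phi_mono[OF z, of y] by simp
    qed
    have "((\<lambda>y. \<bar>C\<bar> * \<bar>y - z\<bar>) \<longlongrightarrow> \<bar>C\<bar> * \<bar>z - z\<bar>) (at z within {0..})"
      by (intro tendsto_intros)
    hence lim: "((\<lambda>y. \<bar>C\<bar> * \<bar>y - z\<bar>) \<longlongrightarrow> 0) (at z within {0..})" by simp
    have "eventually (\<lambda>y. y \<in> {0..} \<and> y < z + 1) (at z within {0..})"
      unfolding eventually_at by (intro exI[of _ 1]) (auto simp: dist_real_def)
    hence "eventually (\<lambda>y. norm (\<phi> y - \<phi> z) \<le> \<bar>C\<bar> * \<bar>y - z\<bar>) (at z within {0..})"
      by (rule eventually_mono) (simp add: bound)
    from this lim have "((\<lambda>y. \<phi> y - \<phi> z) \<longlongrightarrow> 0) (at z within {0..})"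
      by (rule Lim_null_comparison)
    thus ?thesis unfolding continuous_within by (rule LIM_zero_cancel)
  qed
  thus ?thesis by (simp add: continuous_on_eq_continuous_within)
qed

end

section \<open>The cumulant flow\<close>

text \<open>A function that cannot increase while it is positive stays nonpositive: look at the last
  time at which it was \<open>\<le> 0\<close>.\<close>

lemma nonpos_barrier:
  fixes f f' :: "real \<Rightarrow> real"
  assumes T: "0 \<le> T" and f0: "f 0 \<le> 0"
    and der: "\<And>t. t \<ge> 0 \<Longrightarrow> (f has_real_derivative f' t) (at t within {0..})"
    and dec: "\<And>t. t \<ge> 0 \<Longrightarrow> f t > 0 \<Longrightarrow> f' t \<le> 0"
  shows "f T \<le> 0"
proof (rule ccontr)
  assume "\<not> f T \<le> 0"
  hence fT: "f T > 0" by simp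
  have cont: "continuous_on {0..T} f"
    by (rule DERIV_continuous_on[of _ f f']) (auto intro!: has_field_derivative_subset[OF der])
  define S where "S = {t \<in> {0..T}. f t \<le> 0}"
  have S: "compact S" "S \<noteq> {}"
  proof -
    have "S = {0..T} \<inter> f -` {..0}" by (auto simp: S_def)
    hence "closed S"
      using continuous_closed_preimage[OF cont closed_atLeastAtMost closed_atMost] by simp
    moreover have "S \<subseteq> {0..T}" by (auto simp: S_def)
    ultimately show "compact S" using compact_Int_closed[of "{0..T}" S] by (simp add: Int_absorb1)
    show "S \<noteq> {}" using f0 T by (auto simp: S_def)
  qed
  then obtain s where s: "s \<in> S" "\<And>t. t \<in> S \<Longrightarrow> t \<le> s"
    using compact_attains_sup[of S] by blast
  have sT: "0 \<le> s" "s \<le> T" "f s \<le> 0" using s(1) by (auto simp: S_def)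
  have "f T \<le> f s"
  proof (rule DERIV_nonpos_imp_decreasing_open[OF sT(2)])
    fix x assume x: "s < x" "x < T"
    hence "f x > 0" using s(2)[of x] sT by (force simp: S_def)
    moreover have "(f has_real_derivative f' x) (at x)"
    proof -
      have "at x within {0..} = at x" using x sT by (intro at_within_interior) simp
      thus ?thesis using der[of x] x sT by simp
    qed
    ultimately show "\<exists>y. (f has_real_derivative y) (at x) \<and> y \<le> 0"
      using dec[of x] x sT by auto
  qed (rule continuous_on_subset[OF cont], use sT in auto)
  thus False using sT fT by simp
qed

locale cumulant_semigroup = monotone_mechanism +
  fixes v :: "real \<Rightarrow> real \<Rightarrow> real"
  assumes flow: "cumulant_flow \<phi> v"
begin

lemma v_0 [simp]: "l \<ge> 0 \<Longrightarrow> v 0 l = l"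
  and v_nonneg [simp]: "t \<ge> 0 \<Longrightarrow> l \<ge> 0 \<Longrightarrow> 0 \<le> v t l"
  and v_deriv: "t \<ge> 0 \<Longrightarrow> l \<ge> 0 \<Longrightarrow>
    ((\<lambda>s. v s l) has_real_derivative - \<phi> (v t l)) (at t within {0..})"
  using flow by (auto simp: cumulant_flow_def)

text \<open>As \<open>\<phi>\<close> is nondecreasing, the larger of two solutions of \<open>u' = -\<phi>(u)\<close> decreases faster;
  hence solutions keep their order and are determined by their initial values.\<close>

lemma ode_comparison:
  fixes u w :: "real \<Rightarrow> real"
  assumes u: "\<And>t. t \<ge> 0 \<Longrightarrow> u t \<ge> 0"
    "\<And>t. t \<ge> 0 \<Longrightarrow> (u has_real_derivative - \<phi> (u t)) (at t within {0..})"
    and w: "\<And>t. t \<ge> 0 \<Longrightarrow> w t \<ge> 0"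
    "\<And>t. t \<ge> 0 \<Longrightarrow> (w has_real_derivative - \<phi> (w t)) (at t within {0..})"
    and "u 0 \<le> w 0" "t \<ge> 0"
  shows "u t \<le> w t"
proof -
  have "u t - w t \<le> 0"
  proof (rule nonpos_barrier[where f="\<lambda>t. u t - w t" and f'="\<lambda>t. - \<phi> (u t) - - \<phi> (w t)" and T=t])
    show "((\<lambda>t. u t - w t) has_real_derivative - \<phi> (u t) - - \<phi> (w t)) (at t within {0..})"
      if "t \<ge> 0" for t
      using u(2) w(2) that by (intro DERIV_diff) auto
    show "- \<phi> (u t) - - \<phi> (w t) \<le> 0" if "t \<ge> 0" "u t - w t > 0" for t
      using phi_mono[of "w t" "u t"] w(1) that by simp
  qed (use assms in auto)
  thus ?thesis by simp
qed

lemma v_mono: "t \<ge> 0 \<Longrightarrow> 0 \<le> l \<Longrightarrow> l \<le> k \<Longrightarrow> v t l \<le> v t k"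
  by (rule ode_comparison[of "\<lambda>s. v s l" "\<lambda>s. v s k"]) (auto intro: v_deriv)

lemma v_add:
  assumes "s \<ge> 0" "t \<ge> 0" "l \<ge> 0"
  shows "v (s + t) l = v s (v t l)"
proof -
  have shift: "((\<lambda>s. v (s + t) l) has_real_derivative - \<phi> (v (s + t) l)) (at s within {0..})"
    if "s \<ge> 0" for s
  proof -
    have "((\<lambda>s. v s l) has_real_derivative - \<phi> (v (s + t) l)) (at (s + t) within {t..})"
      using assms that by (intro has_field_derivative_subset[OF v_deriv]) auto
    moreover have "(\<lambda>s. s + t) ` {0..} = {t..}"
      using image_add_atLeast[of t 0] by (simp add: add.commute)
    ultimately have "((\<lambda>s. v s l) \<circ> (\<lambda>s. s + t) has_real_derivative - \<phi> (v (s + t) l) * 1) 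
        (at s within {0..})"
      by (intro DERIV_image_chain) (auto intro!: derivative_eq_intros)
    thus ?thesis by (simp add: comp_def)
  qed
  show ?thesis
  proof (rule antisym)
    show "v (s + t) l \<le> v s (v t l)"
      by (rule ode_comparison[of "\<lambda>s. v (s + t) l" "\<lambda>s. v s (v t l)"])
         (use assms in \<open>auto intro: v_deriv shift\<close>)
    show "v s (v t l) \<le> v (s + t) l"
      by (rule ode_comparison[of "\<lambda>s. v s (v t l)" "\<lambda>s. v (s + t) l"])
         (use assms in \<open>auto intro: v_deriv shift\<close>)
  qed
qed

lemma v_le_exp:
  assumes "t \<ge> 0" "l \<ge> 0"
  shows "v t l \<le> l * exp (- b * t)"
proof -
  have "v t l - l * exp (- b * t) \<le> 0"
  proof (rule nonpos_barrier[where T=t and f="\<lambda>t. v t l - l * exp (- b * t)" 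
        and f'="\<lambda>t. - \<phi> (v t l) - l * (exp (- b * t) * - b)"])
    show "((\<lambda>t. v t l - l * exp (- b * t)) has_real_derivative 
        - \<phi> (v t l) - l * (exp (- b * t) * - b)) (at t within {0..})" if "t \<ge> 0" for t
      using that assms by (auto intro!: derivative_eq_intros v_deriv)
    show "- \<phi> (v t l) - l * (exp (- b * t) * - b) \<le> 0" 
      if "t \<ge> 0" "v t l - l * exp (- b * t) > 0" for t
    proof -
      have "b * (l * exp (- b * t)) \<le> b * v t l"
        using that b_pos by (intro mult_left_mono) auto
      thus ?thesis using phi_ge[of "v t l"] that assms by (simp add: algebra_simps)
    qed
  qed (use assms in auto)
  thus ?thesis by simp
qed

lemma v_antimono:
  assumes "0 \<le> s" "s \<le> t" "l \<ge> 0"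
  shows "v t l \<le> v s l"
proof -
  have "v t l = v (t - s) (v s l)" using v_add[of "t - s" s l] assms by simp
  also have "\<dots> \<le> v s l * exp (- b * (t - s))" using assms by (intro v_le_exp) auto
  also have "\<dots> \<le> v s l * 1" using assms b_pos by (intro mult_left_mono) auto
  finally show ?thesis by simp
qed

lemma v_le: "t \<ge> 0 \<Longrightarrow> l \<ge> 0 \<Longrightarrow> v t l \<le> l"
  using v_antimono[of 0 t l] by simp

lemma v_at_0 [simp]: "t \<ge> 0 \<Longrightarrow> v t 0 = 0"
  using v_le[of t 0] v_nonneg[of t 0] by (intro antisym) auto

text \<open>Near \<open>0\<close> the mechanism is dominated by a linear function, so a solution never reaches \<open>0\<close>.\<close>

lemma v_pos:
  assumes "t \<ge> 0" "l > 0"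
  shows "v t l > 0"
proof -
  obtain C where C: "\<And>w z. 0 \<le> w \<Longrightarrow> w \<le> z \<Longrightarrow> z \<le> l \<Longrightarrow> \<phi> z - \<phi> w \<le> C * (z - w)"
    using phi_lipschitz[of l] by blast
  have C: "\<phi> z \<le> C * z" if "0 \<le> z" "z \<le> l" for z
    using C[of 0 z] that phi_0 by simp
  have Cpos: "C \<ge> 0"
  proof -
    have "0 < C * l" using C[of l] phi_pos[of l] assms by simp
    thus ?thesis using assms by (simp add: zero_less_mult_iff)
  qed
  have "l * exp (- C * t) - v t l \<le> 0"
  proof (rule nonpos_barrier[where T=t and f="\<lambda>t. l * exp (- C * t) - v t l" 
        and f'="\<lambda>t. l * (exp (- C * t) * - C) - - \<phi> (v t l)"])
    show "((\<lambda>t. l * exp (- C * t) - v t l) has_real_derivative 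
        l * (exp (- C * t) * - C) - - \<phi> (v t l)) (at t within {0..})" if "t \<ge> 0" for t
      using that assms by (auto intro!: derivative_eq_intros v_deriv)
    show "l * (exp (- C * t) * - C) - - \<phi> (v t l) \<le> 0" 
      if "t \<ge> 0" "l * exp (- C * t) - v t l > 0" for t
    proof -
      have "C * v t l \<le> C * (l * exp (- C * t))"
        using that Cpos by (intro mult_left_mono) auto
      thus ?thesis using C[of "v t l"] v_le[of t l] that assms by (simp add: algebra_simps)
    qed
  qed (use assms in auto)
  moreover have "l * exp (- C * t) > 0" using assms by simp
  ultimately show ?thesis by linarith
qed

lemma continuous_on_v: "l \<ge> 0 \<Longrightarrow> A \<subseteq> {0..} \<Longrightarrow> continuous_on A (\<lambda>s. v s l)"
  by (rule DERIV_continuous_on[of _ _ "\<lambda>s. - \<phi> (v s l)"]) 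
     (auto intro!: has_field_derivative_subset[OF v_deriv])

text \<open>The substitution \<open>z = v\<^sub>s(\<lambda>)\<close>, \<open>dz = -\<phi>(z) ds\<close>.\<close>

lemma integral_along_flow:
  assumes t: "t \<ge> 0" and l: "l > 0" and g: "continuous_on {0<..} g"
  shows "((\<lambda>s. g (v s l) * \<phi> (v s l)) has_integral integral {v t l..l} g) {0..t}"
proof -
  let ?d = "v t l"
  have d: "0 < ?d" "?d \<le> l" using v_pos v_le t l by auto
  have g': "continuous_on {?d..l} g" by (rule continuous_on_subset[OF g]) (use d in auto)
  have range: "v s l \<in> {?d..l}" if "s \<in> {0..t}" for s
    using that l v_antimono[of s t l] v_le[of s l] by auto
  have "((\<lambda>s. - (integral {?d..v s l} g)) has_real_derivative - (g (v s l) * - \<phi> (v s l))) 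
      (at s within {0..t})" if s: "s \<in> {0..t}" for s
  proof -
    have "((\<lambda>x. integral {?d..x} g) has_real_derivative g (v s l)) (at (v s l) within {?d..l})"
      by (rule integral_has_real_derivative[OF g' range[OF s]])
    hence "((\<lambda>x. integral {?d..x} g) has_real_derivative g (v s l)) 
        (at (v s l) within (\<lambda>s. v s l) ` {0..t})"
      by (rule has_field_derivative_subset) (use range in auto)
    moreover have "((\<lambda>s. v s l) has_real_derivative - \<phi> (v s l)) (at s within {0..t})"
      using s l by (intro has_field_derivative_subset[OF v_deriv]) auto
    ultimately have "((\<lambda>x. integral {?d..x} g) \<circ> (\<lambda>s. v s l) has_real_derivative 
        g (v s l) * - \<phi> (v s l)) (at s within {0..t})"
      by (rule DERIV_image_chain)
    thus ?thesis by (intro DERIV_minus) (simp add: comp_def)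
  qed
  hence "((\<lambda>s. - (g (v s l) * - \<phi> (v s l))) has_integral 
      - integral {?d..v t l} g - - integral {?d..v 0 l} g) {0..t}"
    using t by (intro fundamental_theorem_of_calculus) 
      (auto simp: has_real_derivative_iff_has_vector_derivative[symmetric])
  thus ?thesis using l by simp
qed

lemma continuous_on_ratio: "continuous_on {0<..} (\<lambda>z. z / \<phi> z)"
  and continuous_on_inverse_phi: "continuous_on {0<..} (\<lambda>z. 1 / \<phi> z)"
proof -
  have "continuous_on {0<..} \<phi>" by (rule continuous_on_subset[OF continuous_on_phi]) auto
  moreover have "\<phi> z \<noteq> 0" if "z > 0" for z using phi_pos[OF that] by simp
  ultimately show "continuous_on {0<..} (\<lambda>z. z / \<phi> z)" "continuous_on {0<..} (\<lambda>z. 1 / \<phi> z)"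
    by (auto intro!: continuous_intros)
qed

definition immigration_exponent :: "real \<Rightarrow> real" where
  "immigration_exponent l = (LINT z:{0..l}|lborel. z / \<phi> z)"

lemma ratio_bounds:
  assumes "z \<ge> 0" shows "0 \<le> z / \<phi> z" "z / \<phi> z \<le> 1 / b"
proof -
  show "0 \<le> z / \<phi> z" using assms phi_pos[of z] phi_0 by (cases "z = 0") auto
  show "z / \<phi> z \<le> 1 / b"
    using assms phi_ge[of z] phi_pos[of z] b_pos 
    by (cases "z = 0") (auto simp: divide_simps mult.commute)
qed

lemma set_integrable_ratio:
  assumes "k \<ge> 0" shows "set_integrable lborel {k..l} (\<lambda>z. z / \<phi> z)"
proof -
  have meas: "(\<lambda>z. indicator {0<..} z *\<^sub>R (z / \<phi> z)) \<in> borel_measurable borel"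
    by (intro borel_measurable_continuous_on_indicator continuous_on_ratio) simp
  have eq: "indicator {k..l} z *\<^sub>R (z / \<phi> z) 
      = indicator {k..l} z *\<^sub>R (indicator {0<..} z *\<^sub>R (z / \<phi> z))" for z
    using assms by (cases "z = 0") (auto simp: indicator_def)
  have "set_integrable lborel {k..l} (\<lambda>z. 1 / b)"
    by (intro borel_integrable_atLeastAtMost' continuous_intros)
  thus ?thesis
  proof (rule set_integrable_bound)
    have "(\<lambda>z. indicator {k..l} z *\<^sub>R (indicator {0<..} z *\<^sub>R (z / \<phi> z))) \<in> borel_measurable lborel"
      by (rule borel_measurable_scaleR[OF borel_measurable_indicator]) (use meas in simp_all)
    thus "set_borel_measurable lborel {k..l} (\<lambda>z. z / \<phi> z)"
      unfolding set_borel_measurable_def by (subst eq)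
    show "AE z in lborel. z \<in> {k..l} \<longrightarrow> norm (z / \<phi> z) \<le> norm (1 / b)"
    proof (intro AE_I2 impI)
      fix z assume "z \<in> {k..l}"
      hence "z \<ge> 0" using assms by simp
      thus "norm (z / \<phi> z) \<le> norm (1 / b)" 
        unfolding real_norm_def using ratio_bounds[of z] by linarith
    qed
  qed
qed

lemma immigration_exponent_bounds:
  assumes "l \<ge> 0"
  shows "0 \<le> immigration_exponent l" "immigration_exponent l \<le> l / b"
proof -
  show "0 \<le> immigration_exponent l"
    unfolding immigration_exponent_def set_lebesgue_integral_def using ratio_bounds(1)
    by (intro Bochner_Integration.integral_nonneg) (auto simp: indicator_def)
  have "immigration_exponent l \<le> (LINT z:{0..l}|lborel. 1 / b)"
    unfolding immigration_exponent_def using ratio_bounds(2)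
    by (intro set_integral_mono set_integrable_ratio borel_integrable_atLeastAtMost' 
        continuous_intros) auto
  also have "\<dots> = l / b" using assms by (simp add: set_lebesgue_integral_def)
  finally show "immigration_exponent l \<le> l / b" .
qed

lemma immigration_exponent_diff:
  assumes t: "t \<ge> 0" and l: "l \<ge> 0"
  shows "(LINT s:{0..t}|lborel. v s l) = immigration_exponent l - immigration_exponent (v t l)"
proof (cases "l = 0")
  case True
  have "(LINT s:{0..t}|lborel. v s l) = (LINT s:{0..t}|lborel. 0)"
    using True by (intro set_lebesgue_integral_cong) auto
  thus ?thesis using True t by (simp add: set_lebesgue_integral_def)
next
  case False
  hence l: "l > 0" using l by simp
  have d: "0 < v t l" "v t l \<le> l" using v_pos v_le t l by auto
  have "((\<lambda>s. v s l / \<phi> (v s l) * \<phi> (v s l)) has_integral integral {v t l..l} (\<lambda>z. z / \<phi> z)) {0..t}"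
    by (rule integral_along_flow[OF t l continuous_on_ratio])
  moreover have "v s l / \<phi> (v s l) * \<phi> (v s l) = v s l" if "s \<in> {0..t}" for s
    using phi_pos[OF v_pos[of s l]] l that by simp
  ultimately have "((\<lambda>s. v s l) has_integral integral {v t l..l} (\<lambda>z. z / \<phi> z)) {0..t}"
    using has_integral_cong[of "{0..t}"] by (metis (no_types, lifting))
  hence "(LINT s:{0..t}|lborel. v s l) = integral {v t l..l} (\<lambda>z. z / \<phi> z)"
    using l by (subst set_borel_integral_eq_integral) 
      (auto intro!: borel_integrable_atLeastAtMost' continuous_on_v integral_unique)
  also have "\<dots> = integral {0..l} (\<lambda>z. z / \<phi> z) - integral {0..v t l} (\<lambda>z. z / \<phi> z)"
    using Henstock_Kurzweil_Integration.integral_combine[of 0 "v t l" l "\<lambda>z. z / \<phi> z"] d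
      set_borel_integral_eq_integral(1)[OF set_integrable_ratio[of 0 l]] by simp
  also have "\<dots> = immigration_exponent l - immigration_exponent (v t l)"
    unfolding immigration_exponent_def 
    by (simp add: set_borel_integral_eq_integral(2)[OF set_integrable_ratio])
  finally show ?thesis .
qed

text \<open>Integrability of \<open>1/\<phi>\<close> at infinity is what makes the flow come down from infinity:
  descending from \<open>\<lambda>\<close> to \<open>K\<close> takes time \<open>\<integral>\<^sub>K\<^sup>\<lambda> dz/\<phi>(z)\<close>, which is less than \<open>1\<close> for all \<open>\<lambda>\<close> once \<open>K\<close> is
  large.\<close>

lemma v_1_bounded:
  assumes theta: "\<theta> > 0" and int: "set_integrable lborel {\<theta><..} (\<lambda>z. 1 / \<phi> z)"
  obtains K where "\<And>l. l \<ge> 0 \<Longrightarrow> v 1 l \<le> K"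
proof -
  define f where "f z = indicator {\<theta><..} z *\<^sub>R (1 / \<phi> z)" for z
  have f: "integrable lborel f" using int unfolding set_integrable_def f_def .
  have f_nonneg: "f z \<ge> 0" for z
    using theta phi_pos[of z] by (auto simp: f_def indicator_def)
  have f_meas: "f \<in> borel_measurable borel" using borel_measurable_integrable[OF f] by simp
  have f_int: "integrable lborel (\<lambda>z. indicator {real n..} z * f z)" for n
    by (rule Bochner_Integration.integrable_bound[OF f])
       (use f_meas f_nonneg in \<open>auto simp: indicator_def\<close>)
  have "(\<lambda>n. LINT z|lborel. indicator {real n..} z * f z) \<longlonglongrightarrow> (LINT z::real|lborel. 0)"
  proof (rule integral_dominated_convergence[where w=f])
    show "AE z in lborel. (\<lambda>n. indicator {real n..} z * f z) \<longlonglongrightarrow> 0"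
    proof (intro AE_I2 tendsto_eventually)
      fix z :: real
      obtain N where "z < real N" using reals_Archimedean2 by blast
      thus "eventually (\<lambda>n. indicator {real n..} z * f z = 0) sequentially"
        by (intro eventually_sequentiallyI[of N]) (auto simp: indicator_def)
    qed
  qed (use f f_meas f_nonneg in \<open>auto simp: indicator_def\<close>)
  hence "eventually (\<lambda>n. (LINT z|lborel. indicator {real n..} z * f z) < 1) sequentially"
    by (intro order_tendstoD(2)) auto
  moreover have "eventually (\<lambda>n. real n > \<theta>) sequentially"
    using filterlim_real_sequentially by (simp add: filterlim_at_top_dense)
  ultimately obtain n where n: "(LINT z|lborel. indicator {real n..} z * f z) < 1" "real n > \<theta>"
    using eventually_happens[OF eventually_conj] by fastforce
  have "v 1 l \<le> real n" if "l \<ge> 0" for l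
  proof (rule ccontr)
    assume "\<not> v 1 l \<le> real n"
    hence big: "v 1 l > real n" by simp
    hence l: "l > 0" using v_le[of 1 l] that n(2) theta by linarith
    have "((\<lambda>s. 1 / \<phi> (v s l) * \<phi> (v s l)) has_integral integral {v 1 l..l} (\<lambda>z. 1 / \<phi> z)) {0..1}"
      by (rule integral_along_flow[OF _ l continuous_on_inverse_phi]) simp
    moreover have "1 / \<phi> (v s l) * \<phi> (v s l) = 1" if "s \<in> {0..1}" for s
      using phi_pos[OF v_pos[of s l]] l that by simp
    ultimately have "((\<lambda>s. 1) has_integral integral {v 1 l..l} (\<lambda>z. 1 / \<phi> z)) {0..1::real}"
      using has_integral_cong[of "{0..1}"] by (metis (no_types, lifting))
    moreover have "((\<lambda>s. 1::real) has_integral 1) {0..1::real}"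
      using has_integral_const_real[of "1::real" 0 1] by simp
    ultimately have "1 = integral {v 1 l..l} (\<lambda>z. 1 / \<phi> z)" using has_integral_unique by blast
    also have "\<dots> = (LINT z:{v 1 l..l}|lborel. 1 / \<phi> z)"
      using v_pos[of 1 l] l by (intro set_borel_integral_eq_integral(2)[symmetric] 
          borel_integrable_atLeastAtMost' continuous_on_subset[OF continuous_on_inverse_phi]) auto
    also have "\<dots> \<le> (LINT z|lborel. indicator {real n..} z * f z)"
      unfolding set_lebesgue_integral_def
    proof (rule integral_mono[OF _ f_int])
      show "integrable lborel (\<lambda>z. indicator {v 1 l..l} z *\<^sub>R (1 / \<phi> z))"
        using v_pos[of 1 l] l unfolding set_integrable_def[symmetric]
        by (intro borel_integrable_atLeastAtMost' continuous_on_subset[OF continuous_on_inverse_phi]) auto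
      show "indicator {v 1 l..l} z *\<^sub>R (1 / \<phi> z) \<le> indicator {real n..} z * f z" for z
        using f_nonneg[of z] big n(2) by (auto simp: f_def indicator_def)
    qed
    finally show False using n by simp
  qed
  thus thesis using that by blast
qed

lemma v_1_le_vbar:
  assumes bdd: "\<And>l. l \<ge> 0 \<Longrightarrow> v 1 l \<le> K" and l: "l \<ge> 0"
  shows "v 1 l \<le> vbar v 1"
proof -
  define S where "S = (SUP l\<in>{0..}. v 1 l)"
  have bdd': "bdd_above ((\<lambda>l. v 1 l) ` {0..})" using bdd by (intro bdd_aboveI2[where M=K]) auto
  have le: "v 1 l \<le> S" if "l \<ge> 0" for l
    unfolding S_def using that by (intro cSUP_upper[OF _ bdd']) auto
  have "((\<lambda>l. v 1 l) \<longlongrightarrow> S) at_top"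
  proof (rule increasing_tendsto)
    show "eventually (\<lambda>l. v 1 l \<le> S) at_top"
      using eventually_ge_at_top[of 0] by eventually_elim (rule le)
    fix x assume "x < S"
    then obtain k where k: "k \<ge> 0" "x < v 1 k"
      unfolding S_def using less_cSUP_iff[OF _ bdd'] by auto
    show "eventually (\<lambda>l. x < v 1 l) at_top"
      using eventually_ge_at_top[of k] by eventually_elim (use k v_mono[of 1 k] in force)
  qed
  hence "vbar v 1 = S" unfolding vbar_def by (intro tendsto_Lim) auto
  thus ?thesis using le[OF l] by simp
qed

end

section \<open>The process without immigration\<close>

locale cbi = cumulant_semigroup +
  fixes a :: real and P :: "real \<Rightarrow> real \<Rightarrow> real measure"
  assumes a_nonneg: "a \<ge> 0" and cbi: "cbi_semigroup v a P"
begin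

lemma P_kernel: "t \<ge> 0 \<Longrightarrow> P t \<in> borel_nonneg \<rightarrow>\<^sub>M prob_algebra borel_nonneg"
  using cbi by (simp add: cbi_semigroup_def transition_semigroup_def)

lemma P_prob: "t \<ge> 0 \<Longrightarrow> x \<ge> 0 \<Longrightarrow> P t x \<in> prob_nonneg"
  using kernel_prob_nonneg[OF P_kernel] .

lemma laplace_P_integral:
  assumes "t \<ge> 0" "x \<ge> 0" "l \<ge> 0"
  shows "laplace (P t x) l = exp (- x * v t l - a * (LINT s:{0..t}|lborel. v s l))"
  using cbi assms by (simp add: cbi_semigroup_def laplace_def)

lemma laplace_P:
  assumes "t \<ge> 0" "x \<ge> 0" "l \<ge> 0"
  shows "laplace (P t x) l = 
    exp (- x * v t l - a * (immigration_exponent l - immigration_exponent (v t l)))"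
  using laplace_P_integral[OF assms] immigration_exponent_diff[of t l] assms by simp

text \<open>Over a time step \<open>h\<close> immigration shifts the population by about \<open>a h\<close>.  This chain starts
  each step of length \<open>h\<close> from a state lowered by \<open>a h\<close>, and sends states up to \<open>a h\<close> to \<open>0\<close>
  for good, so that in the limit \<open>h \<rightarrow> 0\<close> only branching remains.\<close>

primrec emigration_chain :: "real \<Rightarrow> nat \<Rightarrow> real \<Rightarrow> real measure" where
  "emigration_chain h 0 x = return borel_nonneg x"
| "emigration_chain h (Suc n) x =
    (if x > a * h then P h (max 0 (x - a * h)) \<bind> emigration_chain h n 
     else return borel_nonneg 0)"

lemma emigration_chain_kernel:
  assumes "h \<ge> 0"
  shows "emigration_chain h n \<in> borel_nonneg \<rightarrow>\<^sub>M prob_algebra borel_nonneg"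
proof (induction n)
  case 0
  show ?case unfolding emigration_chain.simps(1)[abs_def] by (rule measurable_return_prob_space)
next
  case (Suc n)
  have "(\<lambda>x. max 0 (x - a * h)) \<in> borel_nonneg \<rightarrow>\<^sub>M borel_nonneg"
    by (intro measurable_restrict_space3) auto
  from measurable_compose[OF this P_kernel[OF assms]]
  have "(\<lambda>x. P h (max 0 (x - a * h)) \<bind> emigration_chain h n) 
      \<in> borel_nonneg \<rightarrow>\<^sub>M prob_algebra borel_nonneg"
    by (rule measurable_bind_prob_space[OF _ Suc.IH])
  moreover have "(\<lambda>x. return borel_nonneg 0) \<in> borel_nonneg \<rightarrow>\<^sub>M prob_algebra borel_nonneg"
    by (rule measurable_const) (rule return_prob_nonneg, simp)
  moreover have "{x \<in> space borel_nonneg. x > a * h} \<in> sets borel_nonneg"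
    by (auto simp: space_restrict_space sets_restrict_space_iff)
  ultimately show ?case
    unfolding emigration_chain.simps(2)[abs_def] by (rule measurable_If)
qed

text \<open>From a state \<open>x > a h\<close> one step turns \<open>e\<^sup>-\<^sup>w\<^sup>y\<close> into at most \<open>exp (- x v\<^sub>h(w))\<close> and at least
  \<open>exp (- a h (w - v\<^sub>h(w)))\<close> times that; these exponents telescope along the flow.  Below \<open>a h\<close> the
  error is at most \<open>a h l\<close>, and a path incurs it only once, since the chain then stays at \<open>0\<close>.\<close>

lemma laplace_emigration_chain:
  assumes h: "h \<ge> 0" and l: "l \<ge> 0" and x: "x \<ge> 0"
  shows "exp (- a * h * (l - v (n * h) l)) * exp (- x * v (n * h) l) 
        \<le> laplace (emigration_chain h n x) l \<and>
      laplace (emigration_chain h n x) l \<le> exp (- x * v (n * h) l) + a * h * l"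
  using x
proof (induction n arbitrary: x)
  case 0
  thus ?case using h l a_nonneg by (simp add: laplace_return mult.commute)
next
  case (Suc n)
  define w where "w = v (n * h) l"
  have w: "0 \<le> w" "w \<le> l" using v_nonneg v_le h l by (auto simp: w_def)
  have vw: "v (Suc n * h) l = v h w"
    using v_add[of h "n * h" l] h l by (simp add: w_def distrib_right add.commute)
  have vh: "0 \<le> v h w" "v h w \<le> w" using w v_le h by auto
  show ?case
  proof (cases "x > a * h")
    case True
    define y where "y = x - a * h"
    have y: "y \<ge> 0" using True by (simp add: y_def)
    define I where "I = (LINT s:{0..h}|lborel. v s w)"
    have intv: "set_integrable lborel {0..h} (\<lambda>s. v s w)"
      using w by (intro borel_integrable_atLeastAtMost' continuous_on_v) auto
    have intc: "set_integrable lborel {0..h} (\<lambda>s. c)" for c :: real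
      by (intro borel_integrable_atLeastAtMost' continuous_intros)
    have const: "(LINT s:{0..h}|lborel. c) = c * h" for c :: real
      using h by (simp add: set_lebesgue_integral_def)
    have I: "v h w * h \<le> I" "I \<le> w * h"
      unfolding I_def const[symmetric] using w
      by (auto intro!: set_integral_mono intc intv v_le v_antimono)
    have step: "laplace (P h y) w = exp (- x * v h w) * exp (- a * (I - v h w * h))"
      unfolding laplace_P_integral[OF h y w(1)] exp_add[symmetric]
      by (simp add: I_def y_def algebra_simps)
    have step_le: "laplace (P h y) w \<le> exp (- x * v h w)"
      unfolding step using I(1) a_nonneg by (intro mult_left_le) auto
    have "a * (I - v h w * h) \<le> a * (h * (w - v h w))"
      using I(2) a_nonneg by (intro mult_left_mono) (auto simp: algebra_simps)
    hence step_ge: "exp (- x * v h w) * exp (- a * h * (w - v h w)) \<le> laplace (P h y) w"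
      unfolding step by (intro mult_left_mono) (auto simp: mult.assoc)
    have Py: "P h y \<in> prob_nonneg" using P_prob h y by simp
    have spy: "space (P h y) = {0..}" by (rule prob_nonnegD[OF Py])
    note K = emigration_chain_kernel[OF h, of n]
    have L: "laplace (emigration_chain h (Suc n) x) l 
        = (LINT z|P h y. laplace (emigration_chain h n z) l)"
      using True y by (simp add: y_def laplace_bind[OF Py[unfolded y_def] K l])
    have intL: "integrable (P h y) (\<lambda>z. laplace (emigration_chain h n z) l)"
    proof (rule integrable_prob_nonneg[OF Py, where B=1])
      show "(\<lambda>z. laplace (emigration_chain h n z) l) \<in> borel_measurable borel_nonneg"
        unfolding laplace_def by (rule integral_kernel_measurable[OF K exp_measurable_nonneg])
      show "\<bar>laplace (emigration_chain h n z) l\<bar> \<le> 1" if "z \<ge> 0" for z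
        using laplace_bounds[OF kernel_prob_nonneg[OF K that] l] by simp
    qed
    have inte: "integrable (P h y) (\<lambda>z. exp (- z * w))"
      using integrable_exp_prob_nonneg[OF Py w(1)] by (simp add: mult.commute)
    have lapw: "(LINT z|P h y. exp (- z * w)) = laplace (P h y) w"
      by (simp add: laplace_def mult.commute)
    have "laplace (emigration_chain h (Suc n) x) l \<le> (LINT z|P h y. exp (- z * w) + a * h * l)"
      unfolding L
    proof (rule integral_mono[OF intL])
      show "integrable (P h y) (\<lambda>z. exp (- z * w) + a * h * l)"
        using inte integrable_prob_nonneg[OF Py, of "\<lambda>_. a * h * l" "\<bar>a * h * l\<bar>"]
        by (intro Bochner_Integration.integrable_add) auto
    qed (use Suc.IH in \<open>auto simp: spy w_def\<close>)
    also have "\<dots> = laplace (P h y) w + a * h * l"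
      using inte integrable_prob_nonneg[OF Py, of "\<lambda>_. a * h * l" "\<bar>a * h * l\<bar>"] lapw
        integral_const_prob_nonneg[OF Py]
      by (subst Bochner_Integration.integral_add) auto
    finally have upper: "laplace (emigration_chain h (Suc n) x) l \<le> exp (- x * v h w) + a * h * l"
      using step_le by linarith
    have "exp (- a * h * (l - v h w)) * exp (- x * v h w) 
        = exp (- a * h * (l - w)) * (exp (- x * v h w) * exp (- a * h * (w - v h w)))"
      unfolding exp_add[symmetric] by (simp add: algebra_simps)
    also have "\<dots> \<le> exp (- a * h * (l - w)) * laplace (P h y) w"
      by (intro mult_left_mono step_ge) auto
    also have "\<dots> = (LINT z|P h y. exp (- a * h * (l - w)) * exp (- z * w))"
      using lapw by simp
    also have "\<dots> \<le> laplace (emigration_chain h (Suc n) x) l"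
      unfolding L using inte
      by (intro integral_mono[OF _ intL]) (use Suc.IH in \<open>auto simp: spy w_def\<close>)
    finally show ?thesis using upper unfolding vw by simp
  next
    case False
    have "x * v h w \<le> a * h * l"
      using False Suc.prems vh w a_nonneg h by (intro mult_mono) auto
    hence "1 \<le> exp (- x * v h w) + a * h * l"
      using exp_ge_add_one_self[of "- x * v h w"] by simp
    moreover have "exp (- a * h * (l - v h w)) * exp (- x * v h w) \<le> 1"
      using a_nonneg h vh w Suc.prems by (intro mult_le_one) auto
    ultimately show ?thesis using False unfolding vw by (simp add: laplace_return)
  qed
qed

text \<open>The law of the descendants of an initial mass \<open>x\<close>, that is, the process without immigration.  Only
  the product of its transform with that of \<open>P\<^sub>t(0, \<cdot>)\<close> is given, so the law itself is obtained as
  the limit of the chains with step \<open>h = t/(n+1)\<close>.\<close>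

lemma branching_law_exists:
  assumes t: "t \<ge> 0" and x: "x \<ge> 0"
  obtains Q where "Q \<in> prob_nonneg" "\<And>l. l \<ge> 0 \<Longrightarrow> laplace Q l = exp (- x * v t l)"
proof -
  define h where "h n = t / real (Suc n)" for n
  have h: "h n \<ge> 0" "real (Suc n) * h n = t" "h n \<le> t" for n
    using t by (auto simp: h_def divide_le_eq mult_le_cancel_left1)
  have h0: "h \<longlonglongrightarrow> 0" unfolding h_def
    using LIMSEQ_Suc[OF lim_const_over_n[of t]] by simp
  define M where "M n = emigration_chain (h n) (Suc n) x" for n
  have M: "M n \<in> prob_nonneg" for n
    unfolding M_def by (rule kernel_prob_nonneg[OF emigration_chain_kernel[OF h(1)] x])
  have bounds: "exp (- a * h n * (l - v t l)) * exp (- x * v t l) \<le> laplace (M n) l"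
      "laplace (M n) l \<le> exp (- x * v t l) + a * h n * l" if "l \<ge> 0" for n l
    using laplace_emigration_chain[OF h(1) that x, of n "Suc n"] unfolding M_def h(2) by auto
  have "(\<lambda>n. laplace (M n) l) \<longlonglongrightarrow> exp (- x * v t l)" if l: "l \<ge> 0" for l
  proof (rule tendsto_sandwich)
    have "(\<lambda>n. exp (- a * h n * (l - v t l)) * exp (- x * v t l)) 
        \<longlonglongrightarrow> exp (- a * 0 * (l - v t l)) * exp (- x * v t l)"
      by (intro tendsto_intros h0)
    thus "(\<lambda>n. exp (- a * h n * (l - v t l)) * exp (- x * v t l)) \<longlonglongrightarrow> exp (- x * v t l)"
      by simp
    have "(\<lambda>n. exp (- x * v t l) + a * h n * l) \<longlonglongrightarrow> exp (- x * v t l) + a * 0 * l"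
      by (intro tendsto_intros h0)
    thus "(\<lambda>n. exp (- x * v t l) + a * h n * l) \<longlonglongrightarrow> exp (- x * v t l)" by simp
  qed (use bounds[OF l] in auto)
  moreover have "exp (- (a * t + x) * l) \<le> laplace (M n) l" if l: "l \<ge> 0" for n l
  proof -
    have vl: "0 \<le> v t l" "v t l \<le> l" using l t v_le by auto
    have "a * h n * (l - v t l) \<le> a * t * l" 
      using a_nonneg h[of n] vl t by (intro mult_mono) (auto intro: mult_left_mono)
    moreover have "x * v t l \<le> x * l" using x vl by (intro mult_left_mono)
    ultimately have "exp (- (a * t + x) * l) \<le> exp (- a * h n * (l - v t l)) * exp (- x * v t l)"
      unfolding exp_add[symmetric] by (simp add: algebra_simps)
    thus ?thesis using bounds(1)[OF l, of n] by linarith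
  qed
  moreover have "0 \<le> a * t + x" using a_nonneg t x by simp
  ultimately show thesis
    using laplace_continuity[of M "\<lambda>l. exp (- x * v t l)" "a * t + x"] M that by blast
qed

text \<open>By the branching property \<open>P\<^sub>t(x, \<cdot>)\<close> is the convolution of \<open>P\<^sub>t(0, \<cdot>)\<close> with the law of the
  descendants of the initial mass \<open>x\<close>.  Both laws agree when there are no descendants, which
  has probability at least \<open>e\<^sup>-\<^sup>x\<^sup>w\<close>.\<close>

lemma integral_P_diff_le:
  fixes f :: "real \<Rightarrow> real"
  assumes t: "t \<ge> 0" and x: "x \<ge> 0" and w: "\<And>l. l \<ge> 0 \<Longrightarrow> v t l \<le> w"
    and f: "f \<in> borel_measurable borel_nonneg" "\<And>y. y \<ge> 0 \<Longrightarrow> \<bar>f y\<bar> \<le> 1"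
  shows "\<bar>integral\<^sup>L (P t x) f - integral\<^sup>L (P t 0) f\<bar> \<le> 2 * (1 - exp (- x * w))"
proof -
  obtain Q where Q: "Q \<in> prob_nonneg" "\<And>l. l \<ge> 0 \<Longrightarrow> laplace Q l = exp (- x * v t l)"
    using branching_law_exists[OF t x] by blast
  interpret Q: prob_space Q by (rule prob_nonnegD[OF Q(1)])
  have P0: "P t 0 \<in> prob_nonneg" using P_prob t by simp
  note S = shift_kernel_measurable[OF P0]
  define g where "g y = integral\<^sup>L (shift_kernel (P t 0) y) f" for y
  have "P t x = Q \<bind> shift_kernel (P t 0)"
  proof (rule laplace_inject[OF P_prob[OF t x] bind_prob_nonneg[OF Q(1) S]])
    fix l :: real assume l: "l \<ge> 0"
    have "laplace (Q \<bind> shift_kernel (P t 0)) l = (LINT y|Q. laplace (shift_kernel (P t 0) y) l)"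
      by (rule laplace_bind[OF Q(1) S l])
    also have "\<dots> = (LINT y|Q. exp (- l * y) * laplace (P t 0) l)"
      by (intro Bochner_Integration.integral_cong refl laplace_shift_kernel[OF P0])
         (simp add: prob_nonnegD(3)[OF Q(1)])
    also have "\<dots> = laplace Q l * laplace (P t 0) l" by (simp add: laplace_def)
    also have "\<dots> = laplace (P t x) l"
      using Q(2)[OF l] laplace_P_integral[OF t _ l] x by (simp add: exp_add[symmetric])
    finally show "laplace (P t x) l = laplace (Q \<bind> shift_kernel (P t 0)) l" by simp
  qed
  hence Px: "integral\<^sup>L (P t x) f = (LINT y|Q. g y)"
    unfolding g_def using integral_bind_prob_nonneg[OF Q(1) S f] by simp
  have g0: "g 0 = integral\<^sup>L (P t 0) f"
    unfolding g_def by (simp add: integral_shift_kernel[OF P0 _ f(1)])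
  have g_meas: "g \<in> borel_measurable borel_nonneg"
    unfolding g_def[abs_def] by (rule integral_kernel_measurable[OF S f(1)])
  have g_le: "\<bar>g y\<bar> \<le> 1" if "y \<ge> 0" for y
    unfolding g_def by (rule abs_integral_le_prob_nonneg[OF kernel_prob_nonneg[OF S that] f])
  have g_int: "integrable Q g" by (rule integrable_prob_nonneg[OF Q(1) g_meas g_le])
  have set: "{0<..} \<in> sets Q"
    by (auto simp: prob_nonnegD(2)[OF Q(1)] sets_restrict_space_iff)
  have "\<bar>integral\<^sup>L (P t x) f - integral\<^sup>L (P t 0) f\<bar> = \<bar>LINT y|Q. g y - g 0\<bar>"
    using g_int by (simp add: Px g0 Q.prob_space)
  also have "\<dots> \<le> (LINT y|Q. \<bar>g y - g 0\<bar>)" by (rule integral_abs_bound)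
  also have "\<dots> \<le> (LINT y|Q. 2 * indicator {0<..} y)"
  proof (rule integral_mono)
    show "integrable Q (\<lambda>y. \<bar>g y - g 0\<bar>)" using g_int by simp
    show "integrable Q (\<lambda>y. 2 * indicator {0<..} y :: real)"
      using set by (intro integrable_mult_right) (simp add: Q.emeasure_eq_measure)
    fix y assume "y \<in> space Q"
    hence "y \<ge> 0" by (simp add: prob_nonnegD(3)[OF Q(1)])
    thus "\<bar>g y - g 0\<bar> \<le> 2 * indicator {0<..} y"
      using g_le[of y] g_le[of 0] by (cases "y = 0") (auto simp: indicator_def)
  qed
  also have "\<dots> = 2 * measure Q {0<..}"
    using sets.sets_into_space[OF set] by (simp add: Int_absorb2)
  also have "\<dots> \<le> 2 * (1 - exp (- x * w))"
  proof -
    have "exp (- x * w) \<le> laplace Q l" if "l \<ge> 0" for l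
      using Q(2)[OF that] w[OF that] x by (simp add: mult_left_mono)
    from measure_pos_le[OF Q(1) this] show ?thesis by simp
  qed
  finally show ?thesis .
qed

end

section \<open>The stationary distribution\<close>

context cbi
begin

lemma immigration_exponent_v_tendsto_0:
  assumes "l \<ge> 0"
  shows "(\<lambda>n. immigration_exponent (v (real n) l)) \<longlonglongrightarrow> 0"
proof (rule tendsto_sandwich[OF _ _ tendsto_const])
  have "(\<lambda>n. l / b * exp (- b) ^ n) \<longlonglongrightarrow> l / b * 0"
    using b_pos by (intro tendsto_mult tendsto_const LIMSEQ_realpow_zero) auto
  thus "(\<lambda>n. l / b * exp (- b) ^ n) \<longlonglongrightarrow> 0" by simp
  have "immigration_exponent (v (real n) l) \<le> l / b * exp (- b) ^ n" for n
  proof -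
    have "immigration_exponent (v (real n) l) \<le> v (real n) l / b"
      using assms by (intro immigration_exponent_bounds) simp
    also have "\<dots> \<le> l * exp (- b * real n) / b"
      using b_pos assms by (intro divide_right_mono v_le_exp) auto
    also have "\<dots> = l / b * exp (- b) ^ n"
      using exp_of_nat_mult[of n "- b"] by (simp add: mult.commute)
    finally show ?thesis .
  qed
  thus "eventually (\<lambda>n. immigration_exponent (v (real n) l) \<le> l / b * exp (- b) ^ n) sequentially"
    by simp
  show "eventually (\<lambda>n. 0 \<le> immigration_exponent (v (real n) l)) sequentially"
    using assms immigration_exponent_bounds(1) by simp
qed

text \<open>The laws \<open>P\<^sub>n(0, \<cdot>)\<close> have Laplace exponents \<open>a (F(\<lambda>) - F(v\<^sub>n(\<lambda>)))\<close> with \<open>F\<close> the immigration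
  exponent, and \<open>F(v\<^sub>n(\<lambda>)) \<rightarrow> 0\<close>.  Since \<open>F(\<lambda>) \<le> \<lambda>/b\<close> no mass escapes, and their limit is a
  probability law with exponent \<open>a F\<close>.\<close>

lemma limit_law_exists:
  obtains \<mu> where "\<mu> \<in> prob_nonneg" 
    "\<And>l. l \<ge> 0 \<Longrightarrow> laplace \<mu> l = exp (- a * immigration_exponent l)"
proof -
  have lap: "laplace (P (real n) 0) l = 
      exp (- a * (immigration_exponent l - immigration_exponent (v (real n) l)))" 
    if "l \<ge> 0" for n l
    using laplace_P[of "real n" 0 l] that by simp
  have "(\<lambda>n. laplace (P (real n) 0) l) \<longlonglongrightarrow> exp (- a * immigration_exponent l)" if l: "l \<ge> 0" for l
  proof -
    have "(\<lambda>n. exp (- a * (immigration_exponent l - immigration_exponent (v (real n) l))))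
      \<longlonglongrightarrow> exp (- a * (immigration_exponent l - 0))"
      by (intro tendsto_intros immigration_exponent_v_tendsto_0 l)
    thus ?thesis using lap[OF l] by simp
  qed
  moreover have "exp (- (a / b) * l) \<le> laplace (P (real n) 0) l" if l: "l \<ge> 0" for n l
  proof -
    have "immigration_exponent l - immigration_exponent (v (real n) l) \<le> l / b"
      using immigration_exponent_bounds(2)[OF l] immigration_exponent_bounds(1)[of "v (real n) l"] l 
      by simp
    from mult_left_mono[OF this a_nonneg] show ?thesis unfolding lap[OF l] by simp
  qed
  moreover have "0 \<le> a / b" using a_nonneg b_pos by simp
  moreover have "P (real n) 0 \<in> prob_nonneg" for n using P_prob by simp
  ultimately show thesis
    using laplace_continuity[of "\<lambda>n. P (real n) 0" "\<lambda>l. exp (- a * immigration_exponent l)" "a / b"] 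
      that by blast
qed

lemma laplace_bind_P:
  assumes M: "M \<in> prob_nonneg" and t: "t \<ge> 0" and l: "l \<ge> 0"
  shows "laplace (M \<bind> P t) l = laplace M (v t l) * 
    exp (- a * (immigration_exponent l - immigration_exponent (v t l)))"
proof -
  let ?c = "exp (- a * (immigration_exponent l - immigration_exponent (v t l)))"
  have "laplace (M \<bind> P t) l = (LINT y|M. laplace (P t y) l)"
    by (rule laplace_bind[OF M P_kernel[OF t] l])
  also have "\<dots> = (LINT y|M. exp (- v t l * y) * ?c)"
  proof (intro Bochner_Integration.integral_cong refl)
    fix y assume "y \<in> space M"
    hence "y \<ge> 0" by (simp add: prob_nonnegD(3)[OF M])
    thus "laplace (P t y) l = exp (- v t l * y) * ?c"
      using laplace_P[OF t _ l, of y] by (simp add: exp_add[symmetric] mult.commute)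
  qed
  also have "\<dots> = laplace M (v t l) * ?c" by (simp add: laplace_def)
  finally show ?thesis .
qed

text \<open>Applying \<open>P\<^sub>t\<close> replaces a transform \<open>L(\<lambda>)\<close> by \<open>L(v\<^sub>t(\<lambda>)) e\<^sup>-\<^sup>a\<^sup>(\<^sup>F\<^sup>(\<^sup>\<lambda>\<^sup>)\<^sup>-\<^sup>F\<^sup>(\<^sup>v\<^sub>t\<^sup>(\<^sup>\<lambda>\<^sup>)\<^sup>)\<^sup>)\<close>.  Iterating the fixed point equation,
  \<open>v\<^sub>n(\<lambda>) \<rightarrow> 0\<close> and \<open>L(0) = 1\<close> leave \<open>e\<^sup>-\<^sup>a\<^sup>F\<close> as its only solution.\<close>

lemma stationary_iff:
  "stationary_distribution borel_nonneg P M \<longleftrightarrow>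
    M \<in> prob_nonneg \<and> (\<forall>l\<ge>0. laplace M l = exp (- a * immigration_exponent l))"
proof safe
  assume st: "stationary_distribution borel_nonneg P M"
  thus M: "M \<in> prob_nonneg" by (simp add: stationary_distribution_def)
  interpret prob_space M by (rule prob_nonnegD[OF M])
  fix l :: real assume l: "l \<ge> 0"
  have "laplace M l = laplace M (v (real n) l) * 
    exp (- a * (immigration_exponent l - immigration_exponent (v (real n) l)))" for n
    using laplace_bind_P[OF M _ l, of "real n"] st by (simp add: stationary_distribution_def)
  note fixed_point = this
  have "(\<lambda>n. laplace M (v (real n) l)) \<longlonglongrightarrow> 1"
  proof -
    have v0: "(\<lambda>n. v (real n) l) \<longlonglongrightarrow> 0"
    proof (rule tendsto_sandwich[OF _ _ tendsto_const])
      have "(\<lambda>n. l * exp (- b) ^ n) \<longlonglongrightarrow> l * 0"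
        using b_pos by (intro tendsto_mult tendsto_const LIMSEQ_realpow_zero) auto
      thus "(\<lambda>n. l * exp (- b * real n)) \<longlonglongrightarrow> 0"
        using exp_of_nat_mult[of _ "- b"] by (simp add: mult.commute)
    qed (use v_le_exp l in auto)
    have "(\<lambda>n. laplace M (v (real n) l)) \<longlonglongrightarrow> (LINT y|M. 1)"
      unfolding laplace_def
    proof (rule integral_dominated_convergence[where w="\<lambda>_. 1"])
      show "AE y in M. (\<lambda>n. exp (- v (real n) l * y)) \<longlonglongrightarrow> 1"
      proof (rule AE_I2)
        fix y
        have "(\<lambda>n. exp (- v (real n) l * y)) \<longlonglongrightarrow> exp (- 0 * y)" by (intro tendsto_intros v0)
        thus "(\<lambda>n. exp (- v (real n) l * y)) \<longlonglongrightarrow> 1" by simp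
      qed
      show "AE y in M. norm (exp (- v (real n) l * y)) \<le> 1" for n
        using l by (intro AE_I2) (simp add: prob_nonnegD(3)[OF M])
    qed (auto intro!: measurable_prob_nonneg[OF M] borel_nonneg_measurable)
    thus ?thesis by (simp add: prob_space)
  qed
  moreover have "(\<lambda>n. exp (- a * (immigration_exponent l - immigration_exponent (v (real n) l))))
      \<longlonglongrightarrow> exp (- a * (immigration_exponent l - 0))"
    by (intro tendsto_intros immigration_exponent_v_tendsto_0 l)
  ultimately have "(\<lambda>n. laplace M (v (real n) l) * 
      exp (- a * (immigration_exponent l - immigration_exponent (v (real n) l))))
      \<longlonglongrightarrow> 1 * exp (- a * (immigration_exponent l - 0))"
    by (rule tendsto_mult)
  hence "(\<lambda>n. laplace M l) \<longlonglongrightarrow> 1 * exp (- a * (immigration_exponent l - 0))"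
    unfolding fixed_point[symmetric] .
  thus "laplace M l = exp (- a * immigration_exponent l)"
    using LIMSEQ_unique[OF tendsto_const] by simp
next
  assume M: "M \<in> prob_nonneg" and L: "\<forall>l\<ge>0. laplace M l = exp (- a * immigration_exponent l)"
  have "M \<bind> P t = M" if t: "t \<ge> 0" for t
  proof (rule laplace_inject[OF bind_prob_nonneg[OF M P_kernel[OF t]] M])
    fix l :: real assume l: "l \<ge> 0"
    show "laplace (M \<bind> P t) l = laplace M l"
      unfolding laplace_bind_P[OF M t l] using L l t by (simp add: exp_add[symmetric] algebra_simps)
  qed
  thus "stationary_distribution borel_nonneg P M" using M by (simp add: stationary_distribution_def)
qed

text \<open>Stationarity writes \<open>\<mu>\<close> as the \<open>\<mu>\<close>-mixture of the laws \<open>P\<^sub>t(y, \<cdot>)\<close>, each of which is compared with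
  \<open>P\<^sub>t(0, \<cdot>)\<close>.  The resulting integral of \<open>1 - e\<^sup>-\<^sup>y\<^sup>w\<close> against \<open>\<mu>\<close> is a value of the known transform.\<close>

lemma integral_stationary_diff_le:
  fixes f :: "real \<Rightarrow> real"
  assumes t: "t \<ge> 0" and w: "\<And>l. l \<ge> 0 \<Longrightarrow> v t l \<le> w"
    and st: "stationary_distribution borel_nonneg P \<mu>"
    and f: "f \<in> borel_measurable borel_nonneg" "\<And>y. y \<ge> 0 \<Longrightarrow> \<bar>f y\<bar> \<le> 1"
  shows "\<bar>integral\<^sup>L (P t 0) f - integral\<^sup>L \<mu> f\<bar> \<le> 2 * a * w / b"
proof -
  have M: "\<mu> \<in> prob_nonneg" and L: "\<And>l. l \<ge> 0 \<Longrightarrow> laplace \<mu> l = exp (- a * immigration_exponent l)"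
    using st by (auto simp: stationary_iff)
  interpret prob_space \<mu> by (rule prob_nonnegD[OF M])
  have w0: "w \<ge> 0" using w[of 0] t by simp
  let ?g = "\<lambda>y. integral\<^sup>L (P t y) f"
  have "integral\<^sup>L (\<mu> \<bind> P t) f = (LINT y|\<mu>. ?g y)"
    by (rule integral_bind_prob_nonneg[OF M P_kernel[OF t] f])
  hence eq: "integral\<^sup>L \<mu> f = (LINT y|\<mu>. ?g y)"
    using st t by (simp add: stationary_distribution_def)
  have int: "integrable \<mu> ?g"
    by (rule integrable_prob_nonneg[OF M integral_kernel_measurable[OF P_kernel[OF t] f(1)]])
       (rule abs_integral_le_prob_nonneg[OF P_prob[OF t] f])
  have inte: "integrable \<mu> (\<lambda>y. exp (- y * w))"
    using integrable_exp_prob_nonneg[OF M w0] by (simp add: mult.commute)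
  have "\<bar>integral\<^sup>L (P t 0) f - integral\<^sup>L \<mu> f\<bar> = \<bar>LINT y|\<mu>. ?g 0 - ?g y\<bar>"
    using int by (simp add: eq prob_space)
  also have "\<dots> \<le> (LINT y|\<mu>. \<bar>?g 0 - ?g y\<bar>)" by (rule integral_abs_bound)
  also have "\<dots> \<le> (LINT y|\<mu>. 2 * (1 - exp (- y * w)))"
  proof (rule integral_mono)
    fix y assume "y \<in> space \<mu>"
    hence "y \<ge> 0" by (simp add: prob_nonnegD(3)[OF M])
    from integral_P_diff_le[OF t this w f]
    show "\<bar>?g 0 - ?g y\<bar> \<le> 2 * (1 - exp (- y * w))" by (simp add: abs_minus_commute)
  qed (use int inte in auto)
  also have "\<dots> = 2 * (1 - laplace \<mu> w)"
    using inte by (simp add: prob_space laplace_def mult.commute)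
  also have "\<dots> \<le> 2 * (a * immigration_exponent w)"
    using L[OF w0] exp_ge_add_one_self[of "- a * immigration_exponent w"] by simp
  also have "\<dots> \<le> 2 * (a * (w / b))"
    using immigration_exponent_bounds(2)[OF w0] a_nonneg by (intro mult_left_mono) auto
  finally show ?thesis by simp
qed

end

section \<open>Exponential ergodicity\<close>

context cbi
begin

lemma var_norm_diff_leI:
  assumes M: "M \<in> prob_nonneg"
    and "\<And>f :: real \<Rightarrow> real. f \<in> borel_measurable borel_nonneg \<Longrightarrow> (\<And>y. y \<ge> 0 \<Longrightarrow> \<bar>f y\<bar> \<le> 1) \<Longrightarrow>
      \<bar>integral\<^sup>L M f - integral\<^sup>L N f\<bar> \<le> C"
  shows "var_norm_diff M N \<le> C"
  unfolding var_norm_diff_def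
proof (rule cSUP_least)
  show "{f \<in> borel_measurable M. \<forall>x\<in>space M. \<bar>f x :: real\<bar> \<le> 1} \<noteq> {}"
    by (auto intro!: exI[of _ "\<lambda>_. 0"])
  fix f :: "real \<Rightarrow> real" assume "f \<in> {f \<in> borel_measurable M. \<forall>x\<in>space M. \<bar>f x\<bar> \<le> 1}"
  thus "\<bar>integral\<^sup>L M f - integral\<^sup>L N f\<bar> \<le> C"
    using measurable_cong_sets[OF prob_nonnegD(2)[OF M] refl] prob_nonnegD(3)[OF M] 
    by (intro assms(2)) auto
qed

text \<open>The bound on \<open>v\<^sub>t\<close> uniform in \<open>\<lambda>\<close> comes from \<open>v\<^sub>t = v\<^sub>t\<^sub>-\<^sub>1 \<circ> v\<^sub>1\<close>: in one unit of time the flow comes down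
  from infinity to \<open>vbar v 1\<close>, and afterwards it decays at rate \<open>b\<close>.\<close>

lemma var_norm_diff_stationary:
  assumes bdd: "\<And>l. l \<ge> 0 \<Longrightarrow> v 1 l \<le> K" 
    and st: "stationary_distribution borel_nonneg P \<mu>" and x: "x \<ge> 0" and t: "t \<ge> 1"
  shows "var_norm_diff (P t x) \<mu> \<le> 2 * (1 - exp (- vbar v 1 * x * exp (- b * (t - 1))))
            + 2 * vbar v 1 * a * inverse b * exp (- b * (t - 1))"
proof (rule var_norm_diff_leI)
  define w where "w = vbar v 1 * exp (- b * (t - 1))"
  have w: "v t l \<le> w" if l: "l \<ge> 0" for l
  proof -
    have "v t l = v (t - 1) (v 1 l)" using v_add[of "t - 1" 1 l] t l by simp
    also have "\<dots> \<le> v 1 l * exp (- b * (t - 1))" using t l by (intro v_le_exp) auto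
    also have "\<dots> \<le> w" unfolding w_def by (intro mult_right_mono v_1_le_vbar[OF bdd l]) auto
    finally show ?thesis .
  qed
  have t0: "t \<ge> 0" using t by simp
  show "P t x \<in> prob_nonneg" using P_prob t0 x by simp
  fix f :: "real \<Rightarrow> real" 
  assume f: "f \<in> borel_measurable borel_nonneg" "\<And>y. y \<ge> 0 \<Longrightarrow> \<bar>f y\<bar> \<le> 1"
  have "\<bar>integral\<^sup>L (P t x) f - integral\<^sup>L \<mu> f\<bar> \<le> 2 * (1 - exp (- x * w)) + 2 * a * w / b"
    using integral_P_diff_le[OF t0 x w f] integral_stationary_diff_le[OF t0 w st f] by linarith
  thus "\<bar>integral\<^sup>L (P t x) f - integral\<^sup>L \<mu> f\<bar> \<le> 2 * (1 - exp (- vbar v 1 * x * exp (- b * (t - 1))))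
            + 2 * vbar v 1 * a * inverse b * exp (- b * (t - 1))"
    by (simp add: w_def field_simps)
qed

lemma exponentially_ergodic_P:
  assumes bdd: "\<And>l. l \<ge> 0 \<Longrightarrow> v 1 l \<le> K" 
    and st: "stationary_distribution borel_nonneg P \<mu>"
  shows "exponentially_ergodic borel_nonneg P"
  unfolding exponentially_ergodic_def
proof (intro exI conjI ballI allI impI)
  define V where "V = vbar v 1"
  define C where "C x = 2 * exp b * (1 + V * x + V * a / b)" for x
  have V: "V \<ge> 0" using v_1_le_vbar[OF bdd, of 0] by (simp add: V_def)
  fix x t :: real assume "x \<in> space borel_nonneg" and t: "t \<ge> 0"
  hence x: "x \<ge> 0" by (simp add: space_restrict_space)
  have Va: "0 \<le> V * a / b" "0 \<le> V * x" using V x a_nonneg b_pos by auto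
  \<comment> \<open>For \<open>t < 1\<close> the norm is at most \<open>2\<close> and \<open>e\<^sup>b e\<^sup>-\<^sup>b\<^sup>t \<ge> 1\<close>, which accounts for the summand \<open>1\<close> in \<open>C\<close>.\<close>
  show "var_norm_diff (P t x) \<mu> \<le> C x * exp (- b * t)"
  proof (cases "t \<ge> 1")
    case True
    define e where "e = exp (- b * (t - 1))"
    have e: "e = exp b * exp (- b * t)" "e \<ge> 0"
      by (auto simp: e_def exp_add[symmetric] algebra_simps)
    have "var_norm_diff (P t x) \<mu> \<le> 2 * (1 - exp (- V * x * e)) + 2 * V * a * inverse b * e"
      using var_norm_diff_stationary[OF bdd st x True] by (simp add: V_def e_def)
    also have "\<dots> \<le> 2 * (V * x * e) + 2 * V * a * inverse b * e"
      using exp_ge_add_one_self[of "- V * x * e"] by simp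
    also have "\<dots> \<le> 2 * (1 + V * x + V * a / b) * e"
      using e(2) by (simp add: algebra_simps divide_inverse)
    finally show ?thesis by (simp only: e(1) C_def mult_ac)
  next
    case False
    have Px: "P t x \<in> prob_nonneg" using P_prob t x by simp
    have M: "\<mu> \<in> prob_nonneg" using st by (simp add: stationary_distribution_def)
    have "var_norm_diff (P t x) \<mu> \<le> 2"
    proof (rule var_norm_diff_leI[OF Px])
      fix f :: "real \<Rightarrow> real" 
      assume f: "f \<in> borel_measurable borel_nonneg" "\<And>y. y \<ge> 0 \<Longrightarrow> \<bar>f y\<bar> \<le> 1"
      show "\<bar>integral\<^sup>L (P t x) f - integral\<^sup>L \<mu> f\<bar> \<le> 2"
        using abs_integral_le_prob_nonneg[OF Px f] abs_integral_le_prob_nonneg[OF M f] by linarith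
    qed
    also have "2 \<le> 2 * (exp b * exp (- b * t)) * 1"
      using False b_pos by (simp add: exp_add[symmetric] mult_le_cancel_left1)
    also have "\<dots> \<le> 2 * (exp b * exp (- b * t)) * (1 + V * x + V * a / b)"
      using Va by (intro mult_left_mono) auto
    finally show ?thesis by (simp only: C_def mult_ac)
  qed
qed (use st b_pos in auto)

end

theorem theorem2p6:
  fixes b \<sigma> a \<theta> :: real
    and m :: "real measure"
    and \<phi> :: "real \<Rightarrow> real"
    and v :: "real \<Rightarrow> real \<Rightarrow> real"
    and P :: "real \<Rightarrow> real \<Rightarrow> real measure"
  assumes sigma: "\<sigma> \<ge> 0"
    and m: "levy_measure m"
    and phi: "\<phi> = branching_mechanism b \<sigma> m"
    and v: "cumulant_flow \<phi> v"
    and a: "a \<ge> 0"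
    and P: "cbi_semigroup v a P"
    and b: "b > 0"
    and theta: "\<theta> > 0"
    and phi_pos: "\<forall>z>\<theta>. \<phi> z > 0"
    and phi_int: "set_integrable lborel {\<theta><..} (\<lambda>z. 1 / \<phi> z)"
  shows "exponentially_ergodic borel_nonneg P \<and>
    (\<exists>\<mu>. stationary_distribution borel_nonneg P \<mu> \<and>
      (\<forall>\<nu>. stationary_distribution borel_nonneg P \<nu> \<longrightarrow> \<nu> = \<mu>) \<and>
      (\<forall>l\<ge>0. (LINT x|\<mu>. exp (- l * x)) =
          exp (- a * (LINT z:{0..l}|lborel. z / \<phi> z))) \<and>
      (\<forall>x\<ge>0. \<forall>t\<ge>1. var_norm_diff (P t x) \<mu> \<le>
          2 * (1 - exp (- vbar v 1 * x * exp (- b * (t - 1))))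
            + 2 * vbar v 1 * a * inverse b * exp (- b * (t - 1))))"
proof -
  interpret monotone_mechanism b \<phi>
    unfolding phi by (rule branching_mechanism_monotone[OF m b])
  interpret cbi b \<phi> v a P
    by unfold_locales (rule v, rule a, rule P)
  obtain K where K: "\<And>l. l \<ge> 0 \<Longrightarrow> v 1 l \<le> K"
    using v_1_bounded[OF theta phi_int] by blast
  obtain \<mu> where \<mu>: "\<mu> \<in> prob_nonneg" 
    "\<And>l. l \<ge> 0 \<Longrightarrow> laplace \<mu> l = exp (- a * immigration_exponent l)"
    using limit_law_exists by blast
  hence st: "stationary_distribution borel_nonneg P \<mu>" by (simp add: stationary_iff)
  have "\<nu> = \<mu>" if "stationary_distribution borel_nonneg P \<nu>" for \<nu>
    using that \<mu> by (intro laplace_inject) (auto simp: stationary_iff)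
  moreover have "(LINT x|\<mu>. exp (- l * x)) = exp (- a * (LINT z:{0..l}|lborel. z / \<phi> z))"
    if "l \<ge> 0" for l
    using \<mu>(2)[OF that] by (simp add: laplace_def immigration_exponent_def)
  ultimately show ?thesis
    using exponentially_ergodic_P[OF K st] st var_norm_diff_stationary[OF K st] by blast
qed

end
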